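(* Let $\Delta,\Gamma$ be finite simplicial complexes. If there is a strongly connected simplicial map $\phi:\Delta\to\Gamma$, then $$\operatorname{elocr}(\Delta)\ge\operatorname{elocr}(\Gamma).$$
   Context: A simplicial complex $\Delta$ on a finite vertex set $V(\Delta)$ is a family of subsets of $V(\Delta)$ (called faces) that is closed under taking subsets and contains all singletons; its edges are its two-element faces. A simplicial map $\phi:\Delta\to\Gamma$ is a map $V(\Delta)\to V(\Gamma)$ taking faces to faces; it is surjective if every face of $\Gamma$ is the image $\phi(T)$ of some face $T\in\Delta$. A surjective simplicial map $\phi:\Delta\to\Gamma$ is strongly connected if: (1) whenever $a,b\in V(\Delta)$ and $\phi(a)=\phi(b)=c\in V(\Gamma)$, there is a sequence $a=x_1,x_2,\dots,x_k=b$ in $V(\Delta)$ with $\phi(x_i)=c$ for all $i$ and $\{x_i,x_{i+1}\}\in\Delta$ for each $1\le i\le k-1$; (2) whenever $a,b$ are edges of $\Delta$ and $\phi(a)=\phi(b)=c$ is an edge of $\Gamma$, there is a sequence of edges $a=e_1,e_2,\dots,e_k=b$ of $\Delta$ with $\phi(e_i)=c$ for all $i$, and $e_i\cup e_{i+1}\in\Delta$ and $e_i\cap e_{i+1}\ne\varnothing$ for each $1\le i\le k-1$. Let $I(\Delta)\subseteq\mathbb{R}[x_i:i\in V(\Delta)]$ be the ideal generated by the monomials $\prod_{i\in S}x_i$ with $S\subseteq V(\Delta)$, $S\notin\Delta$, and let $R_d(\Delta)$ be the degree $d$ homogeneous part of $\mathbb{R}[x_i:i\in V(\Delta)]/I(\Delta)$.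 Elements of $R_d(\Delta)$ are regarded as functions on $\bigcup_{F\in\Delta}\operatorname{span}\{e_i:i\in F\}\subseteq\mathbb{R}^{V(\Delta)}$. Let $\mathcal{P}(\Delta)\subseteq R_2(\Delta)$ be the convex cone of quadratic forms that are nonnegative on this union, and $\Sigma(\Delta)\subseteq\mathcal{P}(\Delta)$ the cone of sums of squares of elements of $R_1(\Delta)$. A nonzero element $x$ of a convex cone $C$ spans an extreme ray if there are no linearly independent $y,z\in C$ with $x=y+z$. The rank of a sum-of-squares form is the least $k$ such that it is a sum of $k$ squares of linear forms. For $q\in\mathcal{P}(\Delta)$ the local rank is $\operatorname{locr}(q)=\max_{F\in\Delta}\operatorname{rank}(q|_{\operatorname{span}\{e_i:i\in F\}})$. A complex is chordal if it is the clique complex (faces are the vertex sets of cliques) of a chordal graph, i.e. a graph with no induced cycle of length at least 4. The extreme local rank $\operatorname{elocr}(\Delta)$ is the maximum of $\operatorname{locr}(q)$ over those $q\in\mathcal{P}(\Delta)\setminus\Sigma(\Delta)$ which span an extreme ray of $\mathcal{P}(\Delta)$; it is defined to be $0$ if $\Delta$ is chordal. *)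

theory Defs
  imports Complex_Main "HOL-Library.Poly_Mapping" "HOL-Algebra.QuotRing"
begin

section \<open>Simplicial complexes and strongly connected maps\<close>

text \<open>
  A complex is represented by its set of faces. Since every vertex is a face, the vertex set is
  recovered as the union of all faces.
\<close>

definition vertices :: "'a set set \<Rightarrow> 'a set" where
  "vertices \<Delta> = \<Union>\<Delta>"

definition finite_complex :: "'a set set \<Rightarrow> bool" where
  "finite_complex \<Delta> \<longleftrightarrow> finite (vertices \<Delta>) \<and> (\<forall>F\<in>\<Delta>. \<forall>G. G \<subseteq> F \<longrightarrow> G \<in> \<Delta>)"

definition edges :: "'a set set \<Rightarrow> 'a set set" where
  "edges \<Delta> = {e \<in> \<Delta>. card e = 2}"

definition simplicial_map :: "'a set set \<Rightarrow> 'b set set \<Rightarrow> ('a \<Rightarrow> 'b) \<Rightarrow> bool" where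
  "simplicial_map \<Delta> \<Gamma> \<phi> \<longleftrightarrow> \<phi> ` vertices \<Delta> \<subseteq> vertices \<Gamma> \<and> (\<forall>T\<in>\<Delta>. \<phi> ` T \<in> \<Gamma>)"

definition surjective_simplicial_map :: "'a set set \<Rightarrow> 'b set set \<Rightarrow> ('a \<Rightarrow> 'b) \<Rightarrow> bool" where
  "surjective_simplicial_map \<Delta> \<Gamma> \<phi> \<longleftrightarrow>
     simplicial_map \<Delta> \<Gamma> \<phi> \<and> (\<forall>F\<in>\<Gamma>. \<exists>T\<in>\<Delta>. \<phi> ` T = F)"

definition strongly_connected_map :: "'a set set \<Rightarrow> 'b set set \<Rightarrow> ('a \<Rightarrow> 'b) \<Rightarrow> bool" where
  "strongly_connected_map \<Delta> \<Gamma> \<phi> \<longleftrightarrow>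
     surjective_simplicial_map \<Delta> \<Gamma> \<phi> \<and>
     (\<forall>a\<in>vertices \<Delta>. \<forall>b\<in>vertices \<Delta>. \<forall>c\<in>vertices \<Gamma>. \<phi> a = c \<and> \<phi> b = c \<longrightarrow>
        (\<exists>k\<ge>1. \<exists>x :: nat \<Rightarrow> 'a. x 1 = a \<and> x k = b \<and>
           (\<forall>i\<in>{1..k}. x i \<in> vertices \<Delta> \<and> \<phi> (x i) = c) \<and>
           (\<forall>i\<in>{1..<k}. {x i, x (i + 1)} \<in> \<Delta>))) \<and>
     (\<forall>a\<in>edges \<Delta>. \<forall>b\<in>edges \<Delta>. \<forall>c\<in>edges \<Gamma>. \<phi> ` a = c \<and> \<phi> ` b = c \<longrightarrow>
        (\<exists>k\<ge>1. \<exists>e :: nat \<Rightarrow> 'a set. e 1 = a \<and> e k = b \<and>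
           (\<forall>i\<in>{1..k}. e i \<in> edges \<Delta> \<and> \<phi> ` e i = c) \<and>
           (\<forall>i\<in>{1..<k}. e i \<union> e (i + 1) \<in> \<Delta> \<and> e i \<inter> e (i + 1) \<noteq> {})))"


section \<open>Chordal complexes\<close>

definition simple_graph :: "'a set \<Rightarrow> 'a set set \<Rightarrow> bool" where
  "simple_graph V E \<longleftrightarrow> (\<forall>e\<in>E. e \<subseteq> V \<and> card e = 2)"

definition induced_cycle :: "'a set \<Rightarrow> 'a set set \<Rightarrow> 'a list \<Rightarrow> bool" where
  "induced_cycle V E vs \<longleftrightarrow>
     length vs \<ge> 3 \<and> distinct vs \<and> set vs \<subseteq> V \<and>
     (\<forall>i j. i < j \<and> j < length vs \<longrightarrow>
        ({vs ! i, vs ! j} \<in> E \<longleftrightarrow> j = i + 1 \<or> (i = 0 \<and> j = length vs - 1)))"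

definition chordal_graph :: "'a set \<Rightarrow> 'a set set \<Rightarrow> bool" where
  "chordal_graph V E \<longleftrightarrow> simple_graph V E \<and> \<not> (\<exists>vs. induced_cycle V E vs \<and> length vs \<ge> 4)"

definition clique_complex :: "'a set \<Rightarrow> 'a set set \<Rightarrow> 'a set set" where
  "clique_complex V E = {S. S \<subseteq> V \<and> (\<forall>u\<in>S. \<forall>v\<in>S. u \<noteq> v \<longrightarrow> {u, v} \<in> E)}"

definition chordal_complex :: "'a set set \<Rightarrow> bool" where
  "chordal_complex \<Delta> \<longleftrightarrow> (\<exists>V E. chordal_graph V E \<and> \<Delta> = clique_complex V E)"


section \<open>The Stanley--Reisner ring\<close>

text \<open>
  Real polynomials in variables indexed by the type \<open>'a\<close>: finitely supported families of
  coefficients, indexed by exponent vectors. Multiplication on this type is convolution, that is,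
  multiplication of polynomials.
\<close>

type_synonym 'a real_poly = "('a \<Rightarrow>\<^sub>0 nat) \<Rightarrow>\<^sub>0 real"

definition const_poly :: "real \<Rightarrow> 'a real_poly" where
  "const_poly c = Poly_Mapping.single 0 c"

definition var_poly :: "'a \<Rightarrow> 'a real_poly" where
  "var_poly i = Poly_Mapping.single (Poly_Mapping.single i 1) 1"

definition eval_poly :: "('a \<Rightarrow> real) \<Rightarrow> 'a real_poly \<Rightarrow> real" where
  "eval_poly x p = (\<Sum>m\<in>Poly_Mapping.keys p. Poly_Mapping.lookup p m *
     (\<Prod>i\<in>Poly_Mapping.keys m. x i ^ Poly_Mapping.lookup m i))"

definition homogeneous :: "nat \<Rightarrow> 'a real_poly \<Rightarrow> bool" where
  "homogeneous d p \<longleftrightarrow>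
     (\<forall>m\<in>Poly_Mapping.keys p. (\<Sum>i\<in>Poly_Mapping.keys m. Poly_Mapping.lookup m i) = d)"

definition poly_ring :: "'a set \<Rightarrow> 'a real_poly ring" where
  "poly_ring V = \<lparr>carrier = {p. \<forall>m\<in>Poly_Mapping.keys p. Poly_Mapping.keys m \<subseteq> V},
     monoid.mult = (*), one = 1, ring.zero = 0, add = (+)\<rparr>"

definition SR_ideal :: "'a set set \<Rightarrow> 'a real_poly set" where
  "SR_ideal \<Delta> =
     genideal (poly_ring (vertices \<Delta>)) {(\<Prod>i\<in>S. var_poly i) | S. S \<subseteq> vertices \<Delta> \<and> S \<notin> \<Delta>}"

definition SR_ring :: "'a set set \<Rightarrow> 'a real_poly set ring" where
  "SR_ring \<Delta> = poly_ring (vertices \<Delta>) Quot SR_ideal \<Delta>"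

definition SR_class :: "'a set set \<Rightarrow> 'a real_poly \<Rightarrow> 'a real_poly set" where
  "SR_class \<Delta> p = SR_ideal \<Delta> +>\<^bsub>poly_ring (vertices \<Delta>)\<^esub> p"

definition SR_part :: "nat \<Rightarrow> 'a set set \<Rightarrow> 'a real_poly set set" where
  "SR_part d \<Delta> = {SR_class \<Delta> p | p. p \<in> carrier (poly_ring (vertices \<Delta>)) \<and> homogeneous d p}"

definition SR_scale :: "'a set set \<Rightarrow> real \<Rightarrow> 'a real_poly set \<Rightarrow> 'a real_poly set" where
  "SR_scale \<Delta> c q = SR_class \<Delta> (const_poly c) \<otimes>\<^bsub>SR_ring \<Delta>\<^esub> q"


section \<open>Nonnegative forms and sums of squares\<close>

text \<open>
  Points of \<open>\<real>\<^sup>V\<close> are functions vanishing outside \<open>V\<close>; the following is the span of the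
  standard basis vectors indexed by \<open>F\<close>.
\<close>

definition coord_span :: "'a set \<Rightarrow> ('a \<Rightarrow> real) set" where
  "coord_span F = {x. \<forall>i. i \<notin> F \<longrightarrow> x i = 0}"

text \<open>
  The value of a residue class at a point of \<open>\<Union>F\<in>\<Delta>. coord_span F\<close>: all representatives have the
  same value there, because the generators of the ideal vanish on this set.
\<close>

definition SR_eval :: "'a real_poly set \<Rightarrow> ('a \<Rightarrow> real) \<Rightarrow> real" where
  "SR_eval q x = the_elem (eval_poly x ` q)"

definition nonneg_cone :: "'a set set \<Rightarrow> 'a real_poly set set" where
  "nonneg_cone \<Delta> = {q \<in> SR_part 2 \<Delta>. \<forall>x \<in> (\<Union>F\<in>\<Delta>. coord_span F). SR_eval q x \<ge> 0}"

definition sos_cone :: "'a set set \<Rightarrow> 'a real_poly set set" where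
  "sos_cone \<Delta> = {(\<Oplus>\<^bsub>SR_ring \<Delta>\<^esub>j\<in>{..<k}. l j \<otimes>\<^bsub>SR_ring \<Delta>\<^esub> l j) | (k :: nat) l.
     \<forall>j<k. l j \<in> SR_part 1 \<Delta>}"

definition SR_independent :: "'a set set \<Rightarrow> 'a real_poly set \<Rightarrow> 'a real_poly set \<Rightarrow> bool" where
  "SR_independent \<Delta> y z \<longleftrightarrow>
     (\<forall>a b. SR_scale \<Delta> a y \<oplus>\<^bsub>SR_ring \<Delta>\<^esub> SR_scale \<Delta> b z = \<zero>\<^bsub>SR_ring \<Delta>\<^esub> \<longrightarrow> a = 0 \<and> b = 0)"

definition spans_extreme_ray ::
    "'a set set \<Rightarrow> 'a real_poly set set \<Rightarrow> 'a real_poly set \<Rightarrow> bool" where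
  "spans_extreme_ray \<Delta> C q \<longleftrightarrow> q \<in> C \<and> q \<noteq> \<zero>\<^bsub>SR_ring \<Delta>\<^esub> \<and>
     \<not> (\<exists>y\<in>C. \<exists>z\<in>C. SR_independent \<Delta> y z \<and> q = y \<oplus>\<^bsub>SR_ring \<Delta>\<^esub> z)"


section \<open>Local rank and extreme local rank\<close>

text \<open>
  The rank of a sum-of-squares form on \<open>coord_span F\<close>, given as a function; \<open>a j\<close> is the coefficient
  vector of the \<open>j\<close>-th linear form. A quadratic form that is nonnegative on \<open>coord_span F\<close> is always
  a sum of squares there, so the minimum is over a nonempty set in all uses below.
\<close>

definition form_rank :: "'a set \<Rightarrow> (('a \<Rightarrow> real) \<Rightarrow> real) \<Rightarrow> nat" where
  "form_rank F f = (LEAST k. \<exists>a :: nat \<Rightarrow> 'a \<Rightarrow> real.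
     \<forall>x\<in>coord_span F. f x = (\<Sum>j<k. (\<Sum>i\<in>F. a j i * x i)\<^sup>2))"

definition local_rank :: "'a set set \<Rightarrow> 'a real_poly set \<Rightarrow> nat" where
  "local_rank \<Delta> q = Max ((\<lambda>F. form_rank F (SR_eval q)) ` \<Delta>)"

text \<open>
  Local ranks are bounded by the number of vertices, so the supremum below is over a finite set of
  natural numbers and is its maximum whenever that set is nonempty (on \<open>nat\<close>, \<open>Sup {} = 0\<close>).
  For a nonempty family of faces that is not chordal, the set is nonempty.
\<close>

definition elocr :: "'a set set \<Rightarrow> nat" where
  "elocr \<Delta> = (if chordal_complex \<Delta> then 0
     else Sup {local_rank \<Delta> q | q. q \<in> nonneg_cone \<Delta> - sos_cone \<Delta> \<and>
                                  spans_extreme_ray \<Delta> (nonneg_cone \<Delta>) q})"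

end

theory Submission
  imports Defs
begin

text \<open>
  A strongly connected map sends \<open>e\<^sub>i\<close> to \<open>e\<^bsub>\<phi> i\<^esub>\<close>, and forms on \<open>\<Gamma>\<close> are pulled back along this linear
  map. A nonnegative summand of a pulled back form vanishes at \<open>e\<^sub>a - e\<^sub>b\<close> for every edge \<open>{a, b}\<close>
  collapsed by \<open>\<phi>\<close>, so \<open>e\<^sub>a - e\<^sub>b\<close> lies in its kernel on each face containing \<open>a\<close> and \<open>b\<close>. Since
  the fibres over vertices and edges are connected, the summand is itself a pullback. Hence pulling
  back preserves extreme rays and reflects sums of squares, and it does not lower the local rank
  because faces lift. It remains to exclude that \<open>\<Delta>\<close> is chordal and \<open>\<Gamma>\<close> is not: \<open>\<Gamma>\<close> arises from \<open>\<Delta>\<close>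
  by contracting edges one at a time, and each contraction preserves chordality.
\<close>

section \<open>Chordality under contraction of edges\<close>

text \<open>Forms are handled as functions on the realization. A class in \<open>SR_part 2\<close>
  is fixed by its values there (\<open>SR_part2_eqI\<close>), and it has a symmetric coefficient
  matrix whose entry at \<open>i\<close>, \<open>j\<close> is determined exactly when {i, j} is a
  face. This shapes the descent of a summand: only entries over vertices and edges can be compared,
  and the kernel argument equates the entries at \<open>a\<close>, \<open>c\<close> and at
  \<open>b\<close>, \<open>c\<close> only if {a, b, c} is a face. Diagonal entries, and those on
  collapsed edges, agree along paths inside a vertex fibre; entries on other edges agree along
  sequences of edges whose consecutive unions are faces. These are the two conditions on a strongly
  connected map. The chordal case needs its own argument because \<open>elocr\<close> is set to 0
  there by definition, not as the value of the supremum. Contraction is delicate in one respect: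
  identifying the ends of an edge need not send a clique complex to a clique complex, since an
  induced 4-cycle through that edge turns into an unfilled triangle. Chordality rules this
  out.\<close>

lemma induced_cycle_Cons:
  "induced_cycle V E (x # ws) \<longleftrightarrow>
     length ws \<ge> 2 \<and> distinct (x # ws) \<and> insert x (set ws) \<subseteq> V \<and>
     (\<forall>i j. i < j \<and> j < length ws \<longrightarrow> ({ws ! i, ws ! j} \<in> E \<longleftrightarrow> j = i + 1)) \<and>
     (\<forall>j < length ws. {x, ws ! j} \<in> E \<longleftrightarrow> j = 0 \<or> j = length ws - 1)"
    (is "?L \<longleftrightarrow> ?R")
proof -
  have eq: "(\<forall>i j. i < j \<and> j < length (x # ws) \<longrightarrow>
        ({(x # ws) ! i, (x # ws) ! j} \<in> E \<longleftrightarrow> j = i + 1 \<or> (i = 0 \<and> j = length (x # ws) - 1))) \<longleftrightarrow>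
     (\<forall>i j. i < j \<and> j < length ws \<longrightarrow> ({ws ! i, ws ! j} \<in> E \<longleftrightarrow> j = i + 1)) \<and>
     (\<forall>j < length ws. {x, ws ! j} \<in> E \<longleftrightarrow> j = 0 \<or> j = length ws - 1)" (is "?P \<longleftrightarrow> ?Q1 \<and> ?Q2")
  proof
    assume P: ?P
    have ?Q1 using P[rule_format, of "Suc _" "Suc _"] by auto
    moreover have ?Q2 using P[rule_format, of 0 "Suc _"] by auto
    ultimately show "?Q1 \<and> ?Q2" ..
  next
    assume Q: "?Q1 \<and> ?Q2"
    show ?P
    proof (intro allI impI)
      fix i j assume ij: "i < j \<and> j < length (x # ws)"
      then obtain j' where j: "j = Suc j'" by (cases j) auto
      show "({(x # ws) ! i, (x # ws) ! j} \<in> E) = (j = i + 1 \<or> (i = 0 \<and> j = length (x # ws) - 1))"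
      proof (cases i)
        case 0 then show ?thesis using Q ij j by auto
      next
        case (Suc i') then show ?thesis using Q ij j by auto
      qed
    qed
  qed
  show ?thesis unfolding induced_cycle_def eq by auto
qed

text \<open>Every vertex of a cycle can thus be moved to the front, where
  \<open>induced_cycle_Cons\<close> reads the rest as an induced path whose two ends are joined to
  that vertex.\<close>

lemma induced_cycle_rotate1:
  assumes "induced_cycle V E vs"
  shows "induced_cycle V E (rotate1 vs)"
proof (cases vs)
  case Nil then show ?thesis using assms by simp
next
  case (Cons x ws)
  note c = assms[unfolded Cons induced_cycle_Cons]
  have "({(ws @ [x]) ! i, (ws @ [x]) ! j} \<in> E) = (j = i + 1 \<or> (i = 0 \<and> j = length ws))"
    if ij: "i < j" "j < Suc (length ws)" for i j
  proof (cases "j = length ws")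
    case True
    then have "{(ws @ [x]) ! i, (ws @ [x]) ! j} = {x, ws ! i}" using ij by (auto simp: nth_append)
    then show ?thesis using c ij True by auto
  next
    case False then show ?thesis using c ij by (auto simp: nth_append)
  qed
  then show ?thesis using c unfolding Cons induced_cycle_def by auto
qed

lemma induced_cycle_rotate: "induced_cycle V E vs \<Longrightarrow> induced_cycle V E (rotate n vs)"
  by (induction n) (auto simp: induced_cycle_rotate1)

lemma rotate_to_front:
  assumes "a \<in> set vs"
  obtains n ws where "rotate n vs = a # ws"
proof -
  obtain us ws where vs: "vs = us @ a # ws" using assms by (meson split_list)
  then have "rotate (length us) vs = a # ws @ us" by (simp add: rotate_append)
  then show ?thesis by (rule that)
qed

lemma induced_cycle_mono_adjacency:
  assumes "induced_cycle V' E' vs" "set vs \<subseteq> V"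
    "\<And>u v. u \<in> set vs \<Longrightarrow> v \<in> set vs \<Longrightarrow> {u, v} \<in> E \<longleftrightarrow> {u, v} \<in> E'"
  shows "induced_cycle V E vs"
proof -
  have "{vs ! i, vs ! j} \<in> E \<longleftrightarrow> {vs ! i, vs ! j} \<in> E'" if "i < j" "j < length vs" for i j
    using that by (intro assms(3)) auto
  then show ?thesis using assms(1,2) unfolding induced_cycle_def by simp
qed

lemma vertices_clique_complex: "vertices (clique_complex V E) = V"
proof
  show "vertices (clique_complex V E) \<subseteq> V" unfolding vertices_def clique_complex_def by blast
  show "V \<subseteq> vertices (clique_complex V E)"
  proof
    fix v assume "v \<in> V"
    then have "{v} \<in> clique_complex V E" unfolding clique_complex_def by simp
    then show "v \<in> vertices (clique_complex V E)" unfolding vertices_def by blast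
  qed
qed

text \<open>The base case of the contraction argument, when no fibre has two vertices left: this is
  a renaming of vertices, and induced cycles are carried back by the inverse of
  \<open>\<phi>\<close>.\<close>

lemma chordal_complex_image_inj:
  assumes "chordal_complex \<Delta>" "inj_on \<phi> (vertices \<Delta>)"
  shows "chordal_complex ((`) \<phi> ` \<Delta>)"
proof -
  obtain V E where ch: "chordal_graph V E" and \<Delta>: "\<Delta> = clique_complex V E"
    using assms(1) unfolding chordal_complex_def by blast
  have inj: "inj_on \<phi> V" using assms(2) by (simp add: \<Delta> vertices_clique_complex)
  have E: "e \<subseteq> V \<and> card e = 2" if "e \<in> E" for e
    using ch that unfolding chordal_graph_def simple_graph_def by blast
  define E' where "E' = (`) \<phi> ` E"
  have adj: "{\<phi> u, \<phi> v} \<in> E' \<longleftrightarrow> {u, v} \<in> E" if "u \<in> V" "v \<in> V" for u v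
  proof
    assume "{\<phi> u, \<phi> v} \<in> E'"
    then obtain e where "e \<in> E" "\<phi> ` e = \<phi> ` {u, v}" unfolding E'_def by auto
    moreover have "e \<subseteq> V" "{u, v} \<subseteq> V" using E[OF \<open>e \<in> E\<close>] that by auto
    ultimately show "{u, v} \<in> E" using inj_on_image_eq_iff[OF inj] by metis
  next
    assume "{u, v} \<in> E"
    then have "\<phi> ` {u, v} \<in> E'" unfolding E'_def by blast
    then show "{\<phi> u, \<phi> v} \<in> E'" by simp
  qed
  have "simple_graph (\<phi> ` V) E'"
    unfolding simple_graph_def E'_def
    using E inj by (auto simp: card_image inj_on_subset subset_iff)
  moreover have False if c: "induced_cycle (\<phi> ` V) E' vs" and l: "length vs \<ge> 4" for vs
  proof -
    define g where "g = the_inv_into V \<phi>"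
    have sub: "set vs \<subseteq> \<phi> ` V" using c unfolding induced_cycle_def by blast
    have gV: "g v \<in> V" and fg: "\<phi> (g v) = v" if "v \<in> set vs" for v
      using that sub inj unfolding g_def
      by (auto simp: the_inv_into_into f_the_inv_into_f subset_iff)
    have "{map g vs ! i, map g vs ! j} \<in> E \<longleftrightarrow> {vs ! i, vs ! j} \<in> E'"
      if "i < j" "j < length vs" for i j
    proof -
      have "vs ! i \<in> set vs" "vs ! j \<in> set vs" using that by auto
      then show ?thesis using adj[OF gV gV, of "vs ! i" "vs ! j"] fg that by simp
    qed
    moreover have "inj_on g (set vs)" using fg by (metis inj_onI)
    ultimately have "induced_cycle V E (map g vs)"
      using c gV unfolding induced_cycle_def by (auto simp: distinct_map)
    then show False using ch l unfolding chordal_graph_def by (metis length_map)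
  qed
  moreover have "(`) \<phi> ` clique_complex V E = clique_complex (\<phi> ` V) E'"
  proof (intro equalityI subsetI)
    fix S assume "S \<in> (`) \<phi> ` clique_complex V E"
    then obtain T where T: "T \<in> clique_complex V E" "S = \<phi> ` T" by blast
    have "{\<phi> u, \<phi> v} \<in> E'" if uv: "u \<in> T" "v \<in> T" "\<phi> u \<noteq> \<phi> v" for u v
    proof -
      have "u \<noteq> v" using uv by blast
      then have "u \<in> V" "v \<in> V" "{u, v} \<in> E" using T(1) uv unfolding clique_complex_def by auto
      then show ?thesis using adj by blast
    qed
    then show "S \<in> clique_complex (\<phi> ` V) E'" using T unfolding clique_complex_def by auto
  next
    fix S assume S: "S \<in> clique_complex (\<phi> ` V) E'"
    define T where "T = {v \<in> V. \<phi> v \<in> S}"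
    have "\<phi> ` T = S" using S unfolding T_def clique_complex_def by auto
    moreover have "{u, v} \<in> E" if uv: "u \<in> T" "v \<in> T" "u \<noteq> v" for u v
    proof -
      have "u \<in> V" "v \<in> V" "\<phi> u \<in> S" "\<phi> v \<in> S" "\<phi> u \<noteq> \<phi> v"
        using uv inj unfolding T_def inj_on_def by auto
      then show ?thesis using adj S unfolding clique_complex_def by blast
    qed
    then have "T \<in> clique_complex V E" unfolding T_def clique_complex_def by blast
    ultimately show "S \<in> (`) \<phi> ` clique_complex V E" by blast
  qed
  ultimately show ?thesis unfolding chordal_complex_def chordal_graph_def \<Delta> by blast
qed

text \<open>An induced cycle of the contracted graph through the merged vertex opens up to one of
  the original graph: the merged vertex is replaced by \<open>a\<close>, by \<open>b\<close>, or by
  the edge between them, so the length stays or grows by one. That the image is again a clique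
  complex also rests on chordality, through 4-cycles containing the edge.\<close>

lemma chordal_complex_contract_edge:
  assumes "chordal_complex \<Delta>" and ab: "{a, b} \<in> \<Delta>" "a \<noteq> b"
  shows "chordal_complex ((`) (id(b := a)) ` \<Delta>)"
proof -
  obtain V E where ch: "chordal_graph V E" and \<Delta>: "\<Delta> = clique_complex V E"
    using assms(1) unfolding chordal_complex_def by blast
  have noc: False if "induced_cycle V E vs" "length vs \<ge> 4" for vs
    using ch that unfolding chordal_graph_def by blast
  have E: "e \<subseteq> V \<and> card e = 2" if "e \<in> E" for e
    using ch that unfolding chordal_graph_def simple_graph_def by blast
  have irr: "{u, u} \<notin> E" for u using E[of "{u,u}"] by auto
  have inV: "u \<in> V" "v \<in> V" if "{u, v} \<in> E" for u v using E[OF that] by auto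
  have abE: "{a, b} \<in> E" and aV: "a \<in> V" and bV: "b \<in> V"
    using ab unfolding \<Delta> clique_complex_def by auto
  define f where "f = id(b := a)"
  \<comment> \<open>The merged vertex keeps the name \<open>a\<close> and inherits the neighbours of
    \<open>b\<close>.\<close>
  define E' where "E' = {{u, v} | u v. u \<noteq> v \<and> u \<noteq> b \<and> v \<noteq> b \<and>
     ({u, v} \<in> E \<or> (u = a \<and> {b, v} \<in> E))}"
  define V' where "V' = V - {b}"
  have E'_iff: "{u, v} \<in> E' \<longleftrightarrow> u \<noteq> v \<and> u \<noteq> b \<and> v \<noteq> b \<and>
      ({u, v} \<in> E \<or> u = a \<and> {b, v} \<in> E \<or> v = a \<and> {b, u} \<in> E)" for u v
  proof -
    have I: "{u, v} \<in> E'" if "u \<noteq> v" "u \<noteq> b" "v \<noteq> b" "{u, v} \<in> E \<or> u = a \<and> {b, v} \<in> E" for u v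
      unfolding E'_def using that by blast
    show ?thesis
    proof
      assume "{u, v} \<in> E'"
      then show "u \<noteq> v \<and> u \<noteq> b \<and> v \<noteq> b \<and>
          ({u, v} \<in> E \<or> u = a \<and> {b, v} \<in> E \<or> v = a \<and> {b, u} \<in> E)"
        unfolding E'_def by (auto simp: doubleton_eq_iff insert_commute)
    next
      assume "u \<noteq> v \<and> u \<noteq> b \<and> v \<noteq> b \<and>
          ({u, v} \<in> E \<or> u = a \<and> {b, v} \<in> E \<or> v = a \<and> {b, u} \<in> E)"
      then show "{u, v} \<in> E'" using I[of u v] I[of v u] by (auto simp: insert_commute)
    qed
  qed
  have adj: "{u, v} \<in> E' \<longleftrightarrow> {u, v} \<in> E" if "u \<noteq> a" "v \<noteq> a" "u \<noteq> b" "v \<noteq> b" for u v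
    using that irr[of u] unfolding E'_iff by (cases "u = v") auto
  have adja: "{a, v} \<in> E' \<longleftrightarrow> {a, v} \<in> E \<or> {b, v} \<in> E" if "v \<noteq> a" "v \<noteq> b" for v
    using that ab unfolding E'_iff by auto
  have "simple_graph V' E'"
    unfolding simple_graph_def E'_def V'_def using inV aV by (auto simp: insert_commute)
  moreover have False if c: "induced_cycle V' E' vs" and l: "length vs \<ge> 4" for vs
  proof -
    have sub: "set vs \<subseteq> V - {b}" using c unfolding induced_cycle_def V'_def by blast
    show False
    proof (cases "a \<in> set vs")
      case False
      have "induced_cycle V E vs"
      proof (rule induced_cycle_mono_adjacency[OF c])
        show "set vs \<subseteq> V" using sub by blast
        show "{u, v} \<in> E \<longleftrightarrow> {u, v} \<in> E'" if "u \<in> set vs" "v \<in> set vs" for u v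
          using that sub False by (intro adj[symmetric]) auto
      qed
      then show False using noc l by blast
    next
      case True
      then obtain n ws where r: "rotate n vs = a # ws" by (rule rotate_to_front)
      then have c': "induced_cycle V' E' (a # ws)" using induced_cycle_rotate[OF c] by metis
      have "length (a # ws) \<ge> 4" using l r by (metis length_rotate)
      then have l': "length ws \<ge> 3" by simp
      note C = c'[unfolded induced_cycle_Cons]
      have w: "v \<noteq> a" "v \<noteq> b" "v \<in> V" if "v \<in> set ws" for v using C that unfolding V'_def by auto
      have nin: "a \<notin> set ws" "b \<notin> set ws" "set ws \<subseteq> V" using w by blast+
      have path: "({ws ! i, ws ! j} \<in> E) = (j = i + 1)" if "i < j" "j < length ws" for i j
      proof -
        have "ws ! i \<in> set ws" "ws ! j \<in> set ws" using that by auto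
        then show ?thesis using C that adj w by metis
      qed
      have ends: "{a, ws ! j} \<in> E \<or> {b, ws ! j} \<in> E \<longleftrightarrow> j = 0 \<or> j = length ws - 1"
        if "j < length ws" for j
        using C that adja[of "ws ! j"] w[OF nth_mem[OF that]] by auto
      let ?m = "length ws - 1"
      \<comment> \<open>One of \<open>a\<close>, \<open>b\<close> sees both ends of the path. By
        \<open>ends\<close> it sees no inner vertex, so it can replace the merged vertex.\<close>
      have one: False if x: "x \<in> {a, b}" "{x, ws ! 0} \<in> E" "{x, ws ! ?m} \<in> E" for x
      proof -
        have "induced_cycle V E (x # ws)"
          unfolding induced_cycle_Cons
          using C path ends x nin aV bV l' by auto
        then show False using noc l' by fastforce
      qed
      \<comment> \<open>The ends are seen by different vertices. By \<open>one\<close>, each sees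
        only its own end, so inserting the edge between \<open>x\<close> and \<open>y\<close> gives
        an induced cycle one vertex longer.\<close>
      have two: False if x: "x \<in> {a, b}" "y \<in> {a, b}" "x \<noteq> y" "{x, ws ! 0} \<in> E" "{y, ws ! ?m} \<in> E"
        for x y
      proof -
        have nx: "{x, ws ! ?m} \<notin> E" and ny: "{y, ws ! 0} \<notin> E" using one x by blast+
        have xy: "{y, x} \<in> E" "{x, y} \<in> E" using x abE by (auto simp: insert_commute)
        have ax: "({x, ws ! j} \<in> E) = (j = 0)" if "j < length ws" for j
          using ends[OF that] x nx by auto
        have ay: "({y, ws ! j} \<in> E) = (j = ?m)" if "j < length ws" for j
          using ends[OF that] x ny by auto
        have p: "({(x # ws) ! i, (x # ws) ! j} \<in> E) = (j = i + 1)"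
          if "i < j" "j < length (x # ws)" for i j
          using that path ax by (cases i; cases j) auto
        have q: "({y, (x # ws) ! j} \<in> E) = (j = 0 \<or> j = length (x # ws) - 1)"
          if "j < length (x # ws)" for j
          using that ay xy l' by (cases j) auto
        have "induced_cycle V E (y # x # ws)"
          unfolding induced_cycle_Cons[of V E y]
          using p q x nin aV bV l' C by auto
        then show False using noc l' by fastforce
      qed
      have "0 < length ws" "?m < length ws" using l' by linarith+
      then have "{a, ws ! 0} \<in> E \<or> {b, ws ! 0} \<in> E" "{a, ws ! ?m} \<in> E \<or> {b, ws ! ?m} \<in> E"
        using ends[of 0] ends[of ?m] by blast+
      then show False using one two ab(2) by (metis insertCI)
    qed
  qed
  moreover have "(`) f ` clique_complex V E = clique_complex V' E'"
  proof (intro equalityI subsetI)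
    fix S assume "S \<in> (`) f ` clique_complex V E"
    then obtain T where T: "T \<in> clique_complex V E" "S = f ` T" by blast
    have "{f u, f v} \<in> E'" if "u \<in> T" "v \<in> T" "f u \<noteq> f v" for u v
    proof -
      have uv: "{u, v} \<in> E" "{v, u} \<in> E" using T that unfolding clique_complex_def by auto
      then show ?thesis
        using that ab(2) unfolding E'_iff f_def by (auto simp: insert_commute split: if_splits)
    qed
    moreover have "f ` T \<subseteq> V'" using T aV ab(2) unfolding clique_complex_def f_def V'_def by auto
    ultimately show "S \<in> clique_complex V' E'" unfolding T(2) clique_complex_def by auto
  next
    fix S assume S: "S \<in> clique_complex V' E'"
    have SV: "S \<subseteq> V" "b \<notin> S" using S unfolding clique_complex_def V'_def by auto
    have S': "{u, v} \<in> E'" if "u \<in> S" "v \<in> S" "u \<noteq> v" for u v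
      using S that unfolding clique_complex_def by blast
    have fS: "f ` S = S" using SV unfolding f_def by (auto simp: image_def)
    have SE: "{u, v} \<in> E" if "u \<in> S - {a}" "v \<in> S - {a}" "u \<noteq> v" for u v
      using S' that adj SV by (metis DiffE insertI1)
    have aE: "{a, v} \<in> E \<or> {b, v} \<in> E" if "a \<in> S" "v \<in> S" "v \<noteq> a" for v
      using S'[of a v] adja[of v] that SV by auto
    show "S \<in> (`) f ` clique_complex V E"
    \<comment> \<open>The face above \<open>S\<close> is \<open>S\<close> itself unless
      \<open>a\<close> lies in it and has a non-neighbour there; then \<open>a\<close> is exchanged
      for \<open>b\<close>.\<close>
    proof (cases "a \<in> S \<and> \<not> (\<forall>v\<in>S - {a}. {a, v} \<in> E)")
      case False
      then have "S \<in> clique_complex V E"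
        using SV SE unfolding clique_complex_def by (auto, metis Diff_iff insert_commute singletonD)
      then show ?thesis using fS by (metis imageI)
    next
      case True
      then obtain c where c: "c \<in> S" "c \<noteq> a" "{a, c} \<notin> E" and aS: "a \<in> S" by blast
      \<comment> \<open>If \<open>b\<close> misses \<open>v\<close>, then \<open>a\<close> sees
        \<open>v\<close>, while \<open>b\<close> sees \<open>c\<close>, which \<open>a\<close>
        misses: the vertices \<open>a\<close>, \<open>b\<close>, \<open>c\<close>, \<open>v\<close>
        form an induced 4-cycle.\<close>
      have bE: "{b, v} \<in> E" if v: "v \<in> S" "v \<noteq> a" for v
      proof (rule ccontr)
        assume nb: "{b, v} \<notin> E"
        have "{b, c} \<in> E" "{a, v} \<in> E" "c \<noteq> v" using aE aS c v nb by auto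
        moreover have "{c, v} \<in> E" using SE c v \<open>c \<noteq> v\<close> by auto
        moreover have "c \<noteq> b" "v \<noteq> b" using c v SV by auto
        ultimately have "induced_cycle V E [a, b, c, v]"
          using c v nb ab aV bV SV abE unfolding induced_cycle_Cons
          by (auto simp: less_Suc_eq insert_commute nth_Cons' numeral_2_eq_2 numeral_3_eq_3)
        then show False using noc by fastforce
      qed
      have "insert b (S - {a}) \<in> clique_complex V E"
        using SV bV SE bE unfolding clique_complex_def by (auto simp: insert_commute)
      moreover have "f ` insert b (S - {a}) = S"
        using SV aS unfolding f_def by (auto simp: image_def)
      ultimately show ?thesis by (metis imageI)
    qed
  qed
  ultimately show ?thesis
    unfolding chordal_complex_def chordal_graph_def \<Delta> f_def by blast
qed

text \<open>Induction on the number of vertices. If \<open>\<phi>\<close> is not injective, some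
  edge lies inside a fibre; contracting it leaves the image under \<open>\<phi>\<close> unchanged
  and maps paths in fibres to paths in fibres.\<close>

lemma chordal_complex_connected_fibres:
  assumes "finite (vertices \<Delta>)" "chordal_complex \<Delta>"
    and "\<And>a b. a \<in> vertices \<Delta> \<Longrightarrow> b \<in> vertices \<Delta> \<Longrightarrow> \<phi> a = \<phi> b \<Longrightarrow>
           (a, b) \<in> {(x, y). {x, y} \<in> \<Delta> \<and> \<phi> x = \<phi> y}\<^sup>*"
  shows "chordal_complex ((`) \<phi> ` \<Delta>)"
  using assms
proof (induction "card (vertices \<Delta>)" arbitrary: \<Delta> rule: less_induct)
  case less
  show ?case
  proof (cases "inj_on \<phi> (vertices \<Delta>)")
    case True
    then show ?thesis using less.prems chordal_complex_image_inj by blast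
  next
    case False
    then obtain u v where "u \<in> vertices \<Delta>" "v \<in> vertices \<Delta>" "\<phi> u = \<phi> v" "u \<noteq> v"
      unfolding inj_on_def by blast
    then have "(u, v) \<in> {(x, y). {x, y} \<in> \<Delta> \<and> \<phi> x = \<phi> y}\<^sup>*" "u \<noteq> v" using less.prems(3) by blast+
    \<comment> \<open>A path between distinct vertices has a step between distinct vertices.\<close>
    then obtain a b where ab: "{a, b} \<in> \<Delta>" "\<phi> a = \<phi> b" "a \<noteq> b"
      by (induction rule: rtrancl_induct) auto
    define f where "f = id(b := a)"
    let ?D = "(`) f ` \<Delta>"
    have \<phi>f: "\<phi> (f x) = \<phi> x" for x using ab unfolding f_def by simp
    have v: "vertices ?D = f ` vertices \<Delta>" unfolding vertices_def by blast
    have "b \<in> vertices \<Delta>" "a \<in> vertices \<Delta>" using ab unfolding vertices_def by blast+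
    then have "f ` vertices \<Delta> \<subset> vertices \<Delta>" using ab unfolding f_def by auto
    then have card: "card (vertices ?D) < card (vertices \<Delta>)" "finite (vertices ?D)"
      using less.prems(1) by (auto simp: psubset_card_mono finite_subset v)
    have con: "(x, y) \<in> {(x, y). {x, y} \<in> ?D \<and> \<phi> x = \<phi> y}\<^sup>*"
      if xy: "x \<in> vertices ?D" "y \<in> vertices ?D" "\<phi> x = \<phi> y" for x y
    proof -
      obtain x' y' where x'y': "x' \<in> vertices \<Delta>" "y' \<in> vertices \<Delta>" "x = f x'" "y = f y'"
        using xy v by blast
      then have "\<phi> x' = \<phi> y'" using xy(3) \<phi>f by simp
      then have "(x', y') \<in> {(x, y). {x, y} \<in> \<Delta> \<and> \<phi> x = \<phi> y}\<^sup>*"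
        using less.prems(3) x'y' by blast
      then have "(f x', f y') \<in> {(x, y). {x, y} \<in> ?D \<and> \<phi> x = \<phi> y}\<^sup>*"
      proof (induction rule: rtrancl_induct)
        case base then show ?case by simp
      next
        case (step y z)
        have "f ` {y, z} \<in> ?D" using step(2) by blast
        then have "(f y, f z) \<in> {(x, y). {x, y} \<in> ?D \<and> \<phi> x = \<phi> y}" using step(2) \<phi>f by simp
        then show ?case using step(3) by (meson rtrancl.rtrancl_into_rtrancl)
      qed
      then show ?thesis using x'y' by simp
    qed
    have "chordal_complex ?D"
      unfolding f_def using chordal_complex_contract_edge less.prems(2) ab by metis
    then have "chordal_complex ((`) \<phi> ` ?D)" using less.hyps[of ?D] card con by blast
    moreover have "(`) \<phi> ` ?D = (`) \<phi> ` \<Delta>" by (auto simp: image_image \<phi>f)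
    ultimately show ?thesis by simp
  qed
qed

section \<open>Quadratic forms\<close>

definition quad :: "'a set \<Rightarrow> ('a \<Rightarrow> 'a \<Rightarrow> real) \<Rightarrow> ('a \<Rightarrow> real) \<Rightarrow> real" where
  "quad V A x = (\<Sum>i\<in>V. \<Sum>j\<in>V. A i j * x i * x j)"

definition bil :: "'a set \<Rightarrow> ('a \<Rightarrow> 'a \<Rightarrow> real) \<Rightarrow> ('a \<Rightarrow> real) \<Rightarrow> ('a \<Rightarrow> real) \<Rightarrow> real" where
  "bil V A x y = (\<Sum>i\<in>V. \<Sum>j\<in>V. A i j * x i * y j)"

lemma quad_bil: "quad V A x = bil V A x x"
  unfolding quad_def bil_def ..

lemma bil_commute:
  assumes "\<And>i j. A i j = A j i"
  shows "bil V A x y = bil V A y x"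
  unfolding bil_def by (subst sum.swap) (auto intro!: sum.cong simp: assms mult.commute mult.left_commute)

lemma quad_add_scale:
  assumes "\<And>i j. A i j = A j i"
  shows "quad V A (\<lambda>i. x i + t * y i) = quad V A x + 2 * t * bil V A x y + t\<^sup>2 * quad V A y"
proof -
  have "quad V A (\<lambda>i. x i + t * y i) =
      bil V A x x + t * bil V A x y + t * bil V A y x + t\<^sup>2 * bil V A y y"
    unfolding quad_bil bil_def sum_distrib_left sum.distrib[symmetric]
    by (intro sum.cong refl) (simp add: algebra_simps power2_eq_square)
  then show ?thesis using bil_commute[of A V x y] assms by (simp add: quad_bil)
qed

lemma sum_indicator:
  assumes "finite V" "b \<in> V"
  shows "(\<Sum>i\<in>V. f i * of_bool (i = b)) = (f b :: real)"
proof -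
  have "(\<Sum>i\<in>V. f i * of_bool (i = b)) = (\<Sum>i\<in>V. if i = b then f i else 0)"
    by (intro sum.cong) auto
  then show ?thesis using assms by simp
qed

lemma bil_indicator:
  assumes "finite V" "k \<in> V"
  shows "bil V A x (\<lambda>i. of_bool (i = k)) = (\<Sum>i\<in>V. A i k * x i)"
  unfolding bil_def using assms by (simp add: sum_indicator)

lemma quad_indicator:
  assumes "finite V" "k \<in> V"
  shows "quad V A (\<lambda>i. of_bool (i = k)) = A k k"
  unfolding quad_bil using assms by (simp add: bil_indicator sum_indicator)

text \<open>The parabola touches zero at \<open>t = 0\<close> with slope \<open>2 * \<beta>\<close>,
  so a nonzero slope would make it negative nearby.\<close>

lemma zero_if_affine_square_nonneg:
  fixes \<beta> \<gamma> :: real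
  assumes "\<And>t. 0 \<le> 2 * t * \<beta> + t\<^sup>2 * \<gamma>"
  shows "\<beta> = 0"
proof (rule ccontr)
  assume n: "\<beta> \<noteq> 0"
  \<comment> \<open>The added 1 keeps \<open>M\<close> positive when \<open>\<gamma> = 0\<close>;
    the point \<open>t = - \<beta> / M\<close> is then close enough to zero for the linear term to
    win.\<close>
  define M where "M = \<bar>\<gamma>\<bar> + 1"
  have M: "M > 0" "\<gamma> < M" unfolding M_def by auto
  have "0 \<le> 2 * (- \<beta> / M) * \<beta> + (- \<beta> / M)\<^sup>2 * \<gamma>" by (rule assms)
  also have "\<dots> = (\<beta>\<^sup>2 / M) * (\<gamma> / M - 2)"
    using M by (simp add: field_simps power2_eq_square)
  finally have "0 \<le> (\<beta>\<^sup>2 / M) * (\<gamma> / M - 2)" .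
  moreover have "\<beta>\<^sup>2 / M > 0" "\<gamma> / M - 2 < 0" using n M by (auto simp: field_simps)
  ultimately show False by (smt (verit) mult_pos_neg)
qed

text \<open>A zero of a nonnegative form lies in its kernel: moving from \<open>e_a - e_b\<close> in
  the direction \<open>e_k\<close> gives a parabola with minimum zero. Both directions lie in the
  span of \<open>a\<close>, \<open>b\<close>, \<open>k\<close>, which is what a face of \<Delta>
  provides.\<close>

lemma quad_kernel:
  assumes A: "\<And>i j. A i j = A j i" and V: "finite V" "a \<in> V" "b \<in> V" "k \<in> V"
    and nonneg: "\<And>x. x \<in> coord_span {a, b, k} \<Longrightarrow> 0 \<le> quad V A x"
    and zero: "quad V A (\<lambda>i. of_bool (i = a) - of_bool (i = b)) = 0"
  shows "A a k = A b k"
proof -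
  let ?u = "\<lambda>i. of_bool (i = a) - of_bool (i = b) :: real" and ?w = "\<lambda>i. of_bool (i = k) :: real"
  have "bil V A ?u ?w = A a k - A b k"
    using V by (simp add: bil_indicator right_diff_distrib sum_subtractf sum_indicator)
  moreover have "bil V A ?u ?w = 0"
  proof (rule zero_if_affine_square_nonneg)
    fix t
    have "0 \<le> quad V A (\<lambda>i. ?u i + t * ?w i)"
      by (rule nonneg) (auto simp: coord_span_def)
    then show "0 \<le> 2 * t * bil V A ?u ?w + t\<^sup>2 * quad V A ?w"
      unfolding quad_add_scale[OF A] by (simp add: zero)
  qed
  ultimately show ?thesis by simp
qed

lemma quad_coord_span:
  assumes "finite V" "F \<subseteq> V" "x \<in> coord_span F"
  shows "quad V A x = quad F A x"
proof -
  have "(\<Sum>j\<in>V. A i j * x i * x j) = (\<Sum>j\<in>F. A i j * x i * x j)" for i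
    using assms by (intro sum.mono_neutral_right) (auto simp: coord_span_def)
  then show ?thesis
    unfolding quad_def using assms
    by simp (intro sum.mono_neutral_right, auto simp: coord_span_def)
qed

text \<open>Diagonalisation by completing the square in one variable at a time. It shows that the
  minimum in \<open>form_rank\<close> is over a nonempty set and bounds it by the size of the
  face.\<close>

lemma quad_sum_squares:
  assumes "finite F" "\<And>i j. A i j = A j i" "\<And>x. x \<in> coord_span F \<Longrightarrow> 0 \<le> quad F A x"
  shows "\<exists>a. \<forall>x\<in>coord_span F. quad F A x = (\<Sum>j<card F. (\<Sum>i\<in>F. a j i * x i)\<^sup>2)"
  using assms
proof (induction F arbitrary: A rule: finite_induct)
  case empty
  then show ?case by (simp add: quad_def)
next
  case (insert v F)
  let ?V = "insert v F"
  have fin: "finite ?V" using insert.hyps by simp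
  \<comment> \<open>Row \<open>v\<close> as a linear form, followed by the Schur complement of the
    entry at \<open>v\<close>. If that entry is 0, division by zero makes the correction vanish, so
    \<open>B\<close> is \<open>A\<close>.\<close>
  define L where "L x = (\<Sum>i\<in>?V. A v i * x i)" for x
  define B where "B i j = A i j - A v i * A v j / A v v" for i j
  have Avv: "A v v \<ge> 0"
    using insert.prems(2)[of "\<lambda>i. of_bool (i = v)"] quad_indicator[OF fin, of v A]
    by (auto simp: coord_span_def)
  \<comment> \<open>A zero diagonal entry forces a zero row: \<open>e_v\<close> is then a zero of
    the form and so lies in its kernel.\<close>
  have row: "A v i = 0" if "A v v = 0" "i \<in> ?V" for i
  proof -
    let ?e = "\<lambda>k j. of_bool (j = k) :: real"
    have "bil ?V A (?e v) (?e i) = 0"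
    proof (rule zero_if_affine_square_nonneg)
      fix t
      have "0 \<le> quad ?V A (\<lambda>j. ?e v j + t * ?e i j)"
        using that by (intro insert.prems(2)) (auto simp: coord_span_def)
      then show "0 \<le> 2 * t * bil ?V A (?e v) (?e i) + t\<^sup>2 * quad ?V A (?e i)"
        unfolding quad_add_scale[OF insert.prems(1)] quad_indicator[OF fin insertI1] that(1) by simp
    qed
    then show ?thesis using that fin by (simp only: bil_indicator sum_indicator insertI1)
  qed
  have B0: "B v i = 0" if "i \<in> ?V" for i
    using row[OF _ that] unfolding B_def by (cases "A v v = 0") auto
  have Bsym: "B i j = B j i" for i j
    unfolding B_def using insert.prems(1)[of i j] by (simp add: mult.commute)
  have split: "quad ?V A x = (L x)\<^sup>2 / A v v + quad ?V B x" for x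
  proof -
    have "(L x)\<^sup>2 / A v v = (\<Sum>i\<in>?V. \<Sum>j\<in>?V. A v i * A v j / A v v * x i * x j)"
      unfolding L_def power2_eq_square sum_product sum_divide_distrib
      by (intro sum.cong refl) (simp add: ac_simps)
    then show ?thesis
      unfolding quad_def B_def sum.distrib[symmetric] by (simp add: sum.distrib[symmetric] algebra_simps)
  qed
  have red: "quad ?V B x = quad F B x" for x
  proof -
    have r: "(\<Sum>j\<in>?V. B i j * x i * x j) = (\<Sum>j\<in>F. B i j * x i * x j)" if "i \<in> ?V" for i
      using insert.hyps B0[OF that] Bsym[of i v] by simp
    have "(\<Sum>j\<in>?V. B v j * x v * x j) = 0" using B0 by (intro sum.neutral) auto
    moreover have "quad ?V B x = (\<Sum>j\<in>?V. B v j * x v * x j) + (\<Sum>i\<in>F. \<Sum>j\<in>?V. B i j * x i * x j)"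
      unfolding quad_def using insert.hyps by simp
    moreover have "(\<Sum>i\<in>F. \<Sum>j\<in>?V. B i j * x i * x j) = quad F B x"
      unfolding quad_def by (intro sum.cong[OF refl] r) simp
    ultimately show ?thesis by simp
  qed
  have "0 \<le> quad F B x" if x: "x \<in> coord_span F" for x
  proof -
    \<comment> \<open>The coordinate at \<open>v\<close> is chosen to make \<open>L\<close> vanish,
      so that \<open>B\<close> inherits nonnegativity from \<open>A\<close>; if the entry at
      \<open>v\<close> is 0, the term with \<open>L\<close> is 0 anyway.\<close>
    define y where "y = x(v := - (\<Sum>i\<in>F. A v i * x i) / A v v)"
    have eqF: "y i = x i" if "i \<in> F" for i using that insert.hyps unfolding y_def by auto
    have "L y = A v v * y v + (\<Sum>i\<in>F. A v i * x i)"
      unfolding L_def using insert.hyps eqF by simp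
    also have "\<dots> = 0" if "A v v \<noteq> 0" using that unfolding y_def by simp
    finally have "(L y)\<^sup>2 / A v v = 0" by (cases "A v v = 0") auto
    moreover have "y \<in> coord_span ?V" using x unfolding y_def coord_span_def by auto
    ultimately have "0 \<le> quad F B y" using insert.prems(2)[of y] split[of y] red[of y] by linarith
    also have "quad F B y = quad F B x" unfolding quad_def by (intro sum.cong refl) (simp add: eqF)
    finally show ?thesis .
  qed
  from insert.IH[OF Bsym this] obtain a
    where a: "\<And>x. x \<in> coord_span F \<Longrightarrow> quad F B x = (\<Sum>j<card F. (\<Sum>i\<in>F. a j i * x i)\<^sup>2)" by blast
  \<comment> \<open>Index \<open>card F\<close> carries the new square; the smaller ones repeat the
    decomposition of \<open>B\<close>, extended by 0 at \<open>v\<close>. For a zero entry at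
    \<open>v\<close> the new square is 0.\<close>
  define a' where "a' j i = (if j < card F then if i = v then 0 else a j i else A v i / sqrt (A v v))" for j i
  show ?case
  proof (intro exI ballI)
    fix x assume "x \<in> coord_span ?V"
    let ?y = "x(v := 0)"
    have "?y \<in> coord_span F" using \<open>x \<in> coord_span ?V\<close> by (auto simp: coord_span_def)
    note a[OF this]
    moreover have "quad F B ?y = quad F B x"
      unfolding quad_def using insert.hyps by (intro sum.cong refl) auto
    moreover have "(\<Sum>i\<in>F. a j i * ?y i) = (\<Sum>i\<in>?V. a' j i * x i)" if "j < card F" for j
    proof -
      have "(\<Sum>i\<in>?V. a' j i * x i) = (\<Sum>i\<in>F. a' j i * x i)"
        using insert.hyps that by (simp add: a'_def)
      also have "\<dots> = (\<Sum>i\<in>F. a j i * ?y i)"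
        using insert.hyps that by (intro sum.cong refl) (auto simp: a'_def)
      finally show ?thesis by simp
    qed
    moreover have "(\<Sum>i\<in>?V. a' (card F) i * x i)\<^sup>2 = (L x)\<^sup>2 / A v v"
    proof -
      have "(\<Sum>i\<in>?V. a' (card F) i * x i) = L x / sqrt (A v v)"
        unfolding L_def sum_divide_distrib a'_def by simp
      then show ?thesis using Avv by (simp add: power_divide)
    qed
    ultimately show "quad ?V A x = (\<Sum>j<card ?V. (\<Sum>i\<in>?V. a' j i * x i)\<^sup>2)"
      using insert.hyps split[of x] red[of x] by simp
  qed
qed

section \<open>The Stanley--Reisner ring as a ring of functions\<close>

lemma monom_eval_superset:
  assumes "finite W" "Poly_Mapping.keys m \<subseteq> W"
  shows "(\<Prod>i\<in>Poly_Mapping.keys m. x i ^ Poly_Mapping.lookup m i) =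
    (\<Prod>i\<in>W. (x i :: real) ^ Poly_Mapping.lookup m i)"
  using assms by (intro prod.mono_neutral_left) (auto simp: in_keys_iff)

lemma eval_poly_superset:
  assumes "finite K" "Poly_Mapping.keys p \<subseteq> K"
  shows "eval_poly x p = (\<Sum>m\<in>K. Poly_Mapping.lookup p m *
     (\<Prod>i\<in>Poly_Mapping.keys m. x i ^ Poly_Mapping.lookup m i))"
  unfolding eval_poly_def using assms by (intro sum.mono_neutral_left) (auto simp: in_keys_iff)

lemma eval_poly_single:
  "eval_poly x (Poly_Mapping.single m c) =
    c * (\<Prod>i\<in>Poly_Mapping.keys m. x i ^ Poly_Mapping.lookup m i)"
  by (subst eval_poly_superset[of "{m}"]) (auto split: if_splits)

lemma eval_poly_zero [simp]: "eval_poly x 0 = 0"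
  unfolding eval_poly_def by simp

lemma eval_poly_add: "eval_poly x (p + q) = eval_poly x p + eval_poly x q"
proof -
  let ?K = "Poly_Mapping.keys p \<union> Poly_Mapping.keys q"
  have "eval_poly x r = (\<Sum>m\<in>?K. Poly_Mapping.lookup r m *
     (\<Prod>i\<in>Poly_Mapping.keys m. x i ^ Poly_Mapping.lookup m i))" if "r \<in> {p, q, p + q}" for r
    using that keys_add[of p q] by (intro eval_poly_superset) auto
  then show ?thesis by (simp add: lookup_add distrib_right sum.distrib)
qed

lemma eval_poly_sum: "eval_poly x (\<Sum>i\<in>I. p i) = (\<Sum>i\<in>I. eval_poly x (p i))"
  by (induction I rule: infinite_finite_induct) (auto simp: eval_poly_add)

lemma real_poly_eq_sum:
  "(p :: 'a real_poly) = (\<Sum>m\<in>Poly_Mapping.keys p. Poly_Mapping.single m (Poly_Mapping.lookup p m))"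
  by (rule poly_mapping_eqI) (simp add: lookup_sum lookup_single when_def in_keys_iff)

text \<open>Expanding both factors into monomials reduces the claim to adding exponents, compared
  over the union of the variables that occur.\<close>

lemma eval_poly_mult: "eval_poly x (p * q) = eval_poly x p * eval_poly x q"
proof -
  have s: "eval_poly x (Poly_Mapping.single m c * Poly_Mapping.single n d) =
      eval_poly x (Poly_Mapping.single m c) * eval_poly x (Poly_Mapping.single n d)" for m n c d
  proof -
    let ?W = "Poly_Mapping.keys m \<union> Poly_Mapping.keys n"
    have W: "(\<Prod>i\<in>Poly_Mapping.keys k. x i ^ Poly_Mapping.lookup k i) =
        (\<Prod>i\<in>?W. x i ^ Poly_Mapping.lookup k i)" if "Poly_Mapping.keys k \<subseteq> ?W" for k
      using that by (intro monom_eval_superset) auto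
    show ?thesis
      unfolding mult_single eval_poly_single W[OF Un_upper1] W[OF Un_upper2] W[OF keys_add]
      by (simp add: lookup_add power_add prod.distrib)
  qed
  have "eval_poly x (p * q) = eval_poly x
     ((\<Sum>m\<in>Poly_Mapping.keys p. Poly_Mapping.single m (Poly_Mapping.lookup p m)) *
      (\<Sum>m\<in>Poly_Mapping.keys q. Poly_Mapping.single m (Poly_Mapping.lookup q m)))"
    using real_poly_eq_sum[of p] real_poly_eq_sum[of q] by simp
  also have "\<dots> = eval_poly x (\<Sum>m\<in>Poly_Mapping.keys p. Poly_Mapping.single m (Poly_Mapping.lookup p m)) *
      eval_poly x (\<Sum>m\<in>Poly_Mapping.keys q. Poly_Mapping.single m (Poly_Mapping.lookup q m))"
    unfolding sum_product eval_poly_sum s ..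
  finally show ?thesis using real_poly_eq_sum[of p] real_poly_eq_sum[of q] by simp
qed

lemma eval_poly_const [simp]: "eval_poly x (const_poly c) = c"
  unfolding const_poly_def eval_poly_single by simp

lemma eval_poly_var [simp]: "eval_poly x (var_poly i) = x i"
  unfolding var_poly_def eval_poly_single by simp

lemma eval_poly_prod: "eval_poly x (\<Prod>i\<in>I. p i) = (\<Prod>i\<in>I. eval_poly x (p i))"
proof (induction I rule: infinite_finite_induct)
  have "eval_poly x 1 = 1" using eval_poly_const[of x 1] by (simp add: const_poly_def)
  then show "\<And>A. infinite A \<Longrightarrow> eval_poly x (prod p A) = (\<Prod>i\<in>A. eval_poly x (p i))"
    "eval_poly x (prod p {}) = (\<Prod>i\<in>{}. eval_poly x (p i))" by simp_all
qed (auto simp: eval_poly_mult)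

section \<open>The polynomial ring and its vanishing ideals\<close>

lemma carrier_poly_ring:
  "p \<in> carrier (poly_ring V) \<longleftrightarrow> (\<forall>m\<in>Poly_Mapping.keys p. Poly_Mapping.keys m \<subseteq> V)"
  by (simp add: poly_ring_def)

lemma poly_ring_add: "p \<in> carrier (poly_ring V) \<Longrightarrow> q \<in> carrier (poly_ring V) \<Longrightarrow>
  p + q \<in> carrier (poly_ring V)"
  unfolding carrier_poly_ring using keys_add[of p q] by blast

lemma poly_ring_uminus: "p \<in> carrier (poly_ring V) \<Longrightarrow> - p \<in> carrier (poly_ring V)"
  unfolding carrier_poly_ring by (simp add: in_keys_iff)

lemma poly_ring_mult: "p \<in> carrier (poly_ring V) \<Longrightarrow> q \<in> carrier (poly_ring V) \<Longrightarrow>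
  p * q \<in> carrier (poly_ring V)"
  unfolding carrier_poly_ring
  by (smt (verit, ccfv_threshold) keys_mult[of p q] Un_iff keys_add mem_Collect_eq subset_eq)

lemma poly_ring_const [simp]: "const_poly c \<in> carrier (poly_ring V)"
  by (simp add: carrier_poly_ring const_poly_def)

lemma poly_ring_var [simp]: "i \<in> V \<Longrightarrow> var_poly i \<in> carrier (poly_ring V)"
  by (simp add: carrier_poly_ring var_poly_def)

lemma poly_ring_zero_one [simp]: "0 \<in> carrier (poly_ring V)" "1 \<in> carrier (poly_ring V)"
  by (auto simp: carrier_poly_ring)

lemma poly_ring_sum: "(\<And>i. i \<in> I \<Longrightarrow> p i \<in> carrier (poly_ring V)) \<Longrightarrow>
  (\<Sum>i\<in>I. p i) \<in> carrier (poly_ring V)"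
  by (induction I rule: infinite_finite_induct) (auto intro: poly_ring_add)

lemma poly_ring_prod: "(\<And>i. i \<in> I \<Longrightarrow> p i \<in> carrier (poly_ring V)) \<Longrightarrow>
  (\<Prod>i\<in>I. p i) \<in> carrier (poly_ring V)"
  by (induction I rule: infinite_finite_induct) (auto intro: poly_ring_mult)

lemma poly_ring_simps:
  "p \<oplus>\<^bsub>poly_ring V\<^esub> q = p + q" "p \<otimes>\<^bsub>poly_ring V\<^esub> q = p * q"
  "\<zero>\<^bsub>poly_ring V\<^esub> = 0" "\<one>\<^bsub>poly_ring V\<^esub> = 1"
  by (auto simp: poly_ring_def)

lemma cring_poly_ring: "cring (poly_ring V)"
proof (rule cringI)
  show "abelian_group (poly_ring V)"
    by (rule abelian_groupI)
      (auto simp: poly_ring_simps poly_ring_add ac_simps intro: bexI[OF _ poly_ring_uminus])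
  show "comm_monoid (poly_ring V)"
    by (rule comm_monoidI) (auto simp: poly_ring_simps poly_ring_mult ac_simps)
qed (auto simp: poly_ring_simps distrib_right)

abbreviation realization :: "'a set set \<Rightarrow> ('a \<Rightarrow> real) set" where
  "realization \<Delta> \<equiv> (\<Union>F\<in>\<Delta>. coord_span F)"

text \<open>With the realization as \<open>X\<close>, this is an ideal that contains every generator
  of the Stanley-Reisner ideal and hence, by minimality, the whole of it.\<close>

lemma ideal_vanishing:
  "ideal {p \<in> carrier (poly_ring V). \<forall>x\<in>X. eval_poly x p = 0} (poly_ring V)"
proof -
  interpret cring "poly_ring V" by (rule cring_poly_ring)
  have minus: "\<ominus>\<^bsub>poly_ring V\<^esub> p = - p" if "p \<in> carrier (poly_ring V)" for p
    using that poly_ring_uminus[OF that] by (intro minus_equality) (auto simp: poly_ring_simps)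
  have em: "eval_poly x (- p) = - eval_poly x p" for x and p :: "'a real_poly"
    using eval_poly_add[of x p "- p"] by simp
  have "subgroup {p \<in> carrier (poly_ring V). \<forall>x\<in>X. eval_poly x p = 0} (add_monoid (poly_ring V))"
    by (rule add.subgroupI)
      (auto intro: poly_ring_add poly_ring_uminus intro!: exI[of _ 0]
        simp: a_inv_def[symmetric] minus poly_ring_simps eval_poly_add em)
  then show ?thesis
    by (rule idealI[OF ring_axioms])
      (auto intro: poly_ring_mult simp: poly_ring_simps eval_poly_mult)
qed

section \<open>Homogeneous polynomials of degree one and two\<close>

definition monom_degree :: "('a \<Rightarrow>\<^sub>0 nat) \<Rightarrow> nat" where
  "monom_degree m = (\<Sum>i\<in>Poly_Mapping.keys m. Poly_Mapping.lookup m i)"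

lemma homogeneous_alt: "homogeneous d p \<longleftrightarrow> (\<forall>m\<in>Poly_Mapping.keys p. monom_degree m = d)"
  by (simp add: homogeneous_def monom_degree_def)

lemma monom_degree_single [simp]: "monom_degree (Poly_Mapping.single i n) = n"
  by (simp add: monom_degree_def)

lemma monom_degree_add: "monom_degree (m + n) = monom_degree m + monom_degree n"
proof -
  let ?W = "Poly_Mapping.keys m \<union> Poly_Mapping.keys n"
  have "monom_degree k = (\<Sum>i\<in>?W. Poly_Mapping.lookup k i)" if "k \<in> {m, n, m + n}" for k
    unfolding monom_degree_def using that keys_add[of m n]
    by (intro sum.mono_neutral_left) (auto simp: in_keys_iff)
  then show ?thesis by (simp add: lookup_add sum.distrib)
qed

lemma monom_degree_SucE:
  assumes "monom_degree m = Suc d"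
  obtains i m' where "m = Poly_Mapping.single i 1 + m'" "monom_degree m' = d"
    "i \<in> Poly_Mapping.keys m" "Poly_Mapping.keys m' \<subseteq> Poly_Mapping.keys m"
proof -
  obtain i where i: "i \<in> Poly_Mapping.keys m"
    using assms unfolding monom_degree_def by fastforce
  define m' where "m' = m - Poly_Mapping.single i 1"
  have m: "m = Poly_Mapping.single i 1 + m'"
    using i unfolding m'_def
    by (intro poly_mapping_eqI) (auto simp: lookup_add lookup_minus lookup_single when_def in_keys_iff)
  have "Poly_Mapping.keys m' \<subseteq> Poly_Mapping.keys m"
    unfolding m'_def by (auto simp: in_keys_iff lookup_minus)
  moreover have "monom_degree m' = d"
    using assms monom_degree_add[of "Poly_Mapping.single i 1" m'] m by simp
  ultimately show ?thesis using that m i by blast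
qed

lemma monom_degree_0: "monom_degree m = 0 \<Longrightarrow> m = 0"
  by (rule poly_mapping_eqI) (auto simp: monom_degree_def in_keys_iff)

lemma monom_degree_1E:
  assumes "monom_degree m = 1"
  obtains i where "m = Poly_Mapping.single i 1" "i \<in> Poly_Mapping.keys m"
  using assms monom_degree_SucE[of m 0] monom_degree_0 by (metis One_nat_def add.right_neutral)

lemma monom_degree_2E:
  assumes "monom_degree m = 2"
  obtains i j where "m = Poly_Mapping.single i 1 + Poly_Mapping.single j 1"
    "i \<in> Poly_Mapping.keys m" "j \<in> Poly_Mapping.keys m"
proof -
  obtain i m' where "m = Poly_Mapping.single i 1 + m'" "monom_degree m' = 1"
    "i \<in> Poly_Mapping.keys m" "Poly_Mapping.keys m' \<subseteq> Poly_Mapping.keys m"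
    using assms monom_degree_SucE[of m 1] by (metis Suc_1)
  moreover from this obtain j where "m' = Poly_Mapping.single j 1" "j \<in> Poly_Mapping.keys m'"
    using monom_degree_1E by blast
  ultimately show ?thesis using that by blast
qed

lemma homogeneous_zero: "homogeneous d 0"
  by (simp add: homogeneous_def)

lemma homogeneous_add: "homogeneous d p \<Longrightarrow> homogeneous d q \<Longrightarrow> homogeneous d (p + q)"
  unfolding homogeneous_def using keys_add[of p q] by blast

lemma homogeneous_sum: "(\<And>i. i \<in> I \<Longrightarrow> homogeneous d (p i)) \<Longrightarrow> homogeneous d (\<Sum>i\<in>I. p i)"
  by (induction I rule: infinite_finite_induct) (auto intro: homogeneous_add homogeneous_zero)

lemma homogeneous_mult:
  assumes "homogeneous d p" "homogeneous e q"
  shows "homogeneous (d + e) (p * q)"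
  unfolding homogeneous_alt
proof
  fix m assume "m \<in> Poly_Mapping.keys (p * q)"
  then obtain k n where "k \<in> Poly_Mapping.keys p" "n \<in> Poly_Mapping.keys q" "m = k + n"
    using keys_mult[of p q] by blast
  then show "monom_degree m = d + e" using assms by (simp add: homogeneous_alt monom_degree_add)
qed

lemma homogeneous_const: "homogeneous 0 (const_poly c)"
  by (auto simp: homogeneous_def const_poly_def)

lemma homogeneous_var: "homogeneous 1 (var_poly i)"
  by (simp add: homogeneous_alt var_poly_def)

lemma const_poly_add: "const_poly (a + b) = const_poly a + const_poly b"
  by (simp add: const_poly_def single_add)

lemma const_poly_zero [simp]: "const_poly 0 = 0"
  by (simp add: const_poly_def)

definition lin_poly :: "'a set \<Rightarrow> ('a \<Rightarrow> real) \<Rightarrow> 'a real_poly" where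
  "lin_poly V a = (\<Sum>i\<in>V. const_poly (a i) * var_poly i)"

definition quad_poly :: "'a set \<Rightarrow> ('a \<Rightarrow> 'a \<Rightarrow> real) \<Rightarrow> 'a real_poly" where
  "quad_poly V A = (\<Sum>i\<in>V. \<Sum>j\<in>V. const_poly (A i j) * (var_poly i * var_poly j))"

lemma eval_lin_poly: "eval_poly x (lin_poly V a) = (\<Sum>i\<in>V. a i * x i)"
  by (simp add: lin_poly_def eval_poly_sum eval_poly_mult)

lemma eval_quad_poly: "eval_poly x (quad_poly V A) = quad V A x"
  by (simp add: quad_poly_def quad_def eval_poly_sum eval_poly_mult mult.assoc)

lemma homogeneous_lin_poly: "homogeneous 1 (lin_poly V a)"
  unfolding lin_poly_def
  using homogeneous_mult[OF homogeneous_const homogeneous_var]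
  by (intro homogeneous_sum) simp

lemma homogeneous_quad_poly: "homogeneous 2 (quad_poly V A)"
  unfolding quad_poly_def
  using homogeneous_mult[OF homogeneous_const homogeneous_mult[OF homogeneous_var homogeneous_var]]
  by (intro homogeneous_sum) (simp add: numeral_2_eq_2)

lemma lin_poly_carrier: "lin_poly V a \<in> carrier (poly_ring V)"
  unfolding lin_poly_def by (auto intro!: poly_ring_sum poly_ring_mult)

lemma quad_poly_carrier: "quad_poly V A \<in> carrier (poly_ring V)"
  unfolding quad_poly_def by (auto intro!: poly_ring_sum poly_ring_mult)

lemma lin_poly_add: "lin_poly V (\<lambda>i. a i + b i) = lin_poly V a + lin_poly V b"
  by (simp add: lin_poly_def const_poly_add distrib_right sum.distrib)

lemma quad_poly_add: "quad_poly V (\<lambda>i j. A i j + B i j) = quad_poly V A + quad_poly V B"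
  by (simp add: quad_poly_def const_poly_add distrib_right sum.distrib)

lemma homogeneous_1_lin_poly:
  assumes "finite V" "p \<in> carrier (poly_ring V)" "homogeneous 1 p"
  shows "\<exists>a. p = lin_poly V a"
proof -
  have single: "\<exists>a. Poly_Mapping.single m c = lin_poly V a"
    if m: "monom_degree m = 1" "Poly_Mapping.keys m \<subseteq> V" for m c
  proof -
    obtain i where i: "m = Poly_Mapping.single i 1" "i \<in> V"
      using monom_degree_1E[OF m(1)] m(2) by blast
    have "lin_poly V (\<lambda>k. if k = i then c else 0) =
        (\<Sum>k\<in>V. if k = i then const_poly c * var_poly k else 0)"
      unfolding lin_poly_def by (intro sum.cong) auto
    also have "\<dots> = Poly_Mapping.single m c"
      using assms(1) i by (simp add: const_poly_def var_poly_def mult_single)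
    finally show ?thesis by metis
  qed
  have zero: "lin_poly V (\<lambda>_. 0) = 0" by (simp add: lin_poly_def)
  have "\<exists>a. (\<Sum>m\<in>K. Poly_Mapping.single m (c m)) = lin_poly V a"
    if "finite K" "\<forall>m\<in>K. monom_degree m = 1 \<and> Poly_Mapping.keys m \<subseteq> V" for K c
    using that
  proof (induction K rule: finite_induct)
    case empty
    then show ?case using zero by (metis sum.empty)
  next
    case (insert m K)
    have "\<exists>A. Poly_Mapping.single m (c m) = lin_poly V A"
      using insert.prems by (intro single) auto
    moreover have "\<exists>B. (\<Sum>m\<in>K. Poly_Mapping.single m (c m)) = lin_poly V B"
      using insert.IH insert.prems by blast
    ultimately obtain A B where "Poly_Mapping.single m (c m) = lin_poly V A"
      "(\<Sum>m\<in>K. Poly_Mapping.single m (c m)) = lin_poly V B" by blast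
    then have "(\<Sum>m\<in>insert m K. Poly_Mapping.single m (c m)) =
        lin_poly V (\<lambda>i. A i + B i)"
      using insert.hyps by (simp add: lin_poly_add)
    then show ?case by blast
  qed
  from this[of "Poly_Mapping.keys p" "Poly_Mapping.lookup p"] show ?thesis
    using assms(2,3) real_poly_eq_sum[of p] by (simp add: carrier_poly_ring homogeneous_alt)
qed

text \<open>A monomial of degree two gets a matrix supported at one entry, and sums of polynomials
  correspond to sums of matrices.\<close>

lemma homogeneous_2_quad_poly:
  assumes "finite V" "p \<in> carrier (poly_ring V)" "homogeneous 2 p"
  shows "\<exists>A. (\<forall>i j. A i j = A j i) \<and> p = quad_poly V A"
proof -
  have single: "\<exists>A. Poly_Mapping.single m c = quad_poly V A"
    if m: "monom_degree m = 2" "Poly_Mapping.keys m \<subseteq> V" for m c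
  proof -
    obtain i j where ij: "m = Poly_Mapping.single i 1 + Poly_Mapping.single j 1" "i \<in> V" "j \<in> V"
      by (rule monom_degree_2E[OF m(1)], rule that, assumption) (use m(2) in \<open>blast+\<close>)
    have "quad_poly V (\<lambda>k l. if k = i then if l = j then c else 0 else 0) =
        (\<Sum>k\<in>V. if k = i then \<Sum>l\<in>V. if l = j then const_poly c * (var_poly k * var_poly l) else 0 else 0)"
      unfolding quad_poly_def by (intro sum.cong) (auto intro!: sum.cong)
    also have "\<dots> = Poly_Mapping.single m c"
      using assms(1) ij by (simp add: const_poly_def var_poly_def mult_single)
    finally show ?thesis by metis
  qed
  have zero: "quad_poly V (\<lambda>_ _. 0) = 0" by (simp add: quad_poly_def)
  have "\<exists>A. (\<Sum>m\<in>K. Poly_Mapping.single m (c m)) = quad_poly V A"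
    if "finite K" "\<forall>m\<in>K. monom_degree m = 2 \<and> Poly_Mapping.keys m \<subseteq> V" for K c
    using that
  proof (induction K rule: finite_induct)
    case empty
    then show ?case using zero by (metis sum.empty)
  next
    case (insert m K)
    have "\<exists>A. Poly_Mapping.single m (c m) = quad_poly V A"
      using insert.prems by (intro single) auto
    moreover have "\<exists>B. (\<Sum>m\<in>K. Poly_Mapping.single m (c m)) = quad_poly V B"
      using insert.IH insert.prems by blast
    ultimately obtain A B where "Poly_Mapping.single m (c m) = quad_poly V A"
      "(\<Sum>m\<in>K. Poly_Mapping.single m (c m)) = quad_poly V B" by blast
    then have "(\<Sum>m\<in>insert m K. Poly_Mapping.single m (c m)) =
        quad_poly V (\<lambda>i j. A i j + B i j)"
      using insert.hyps by (simp add: quad_poly_add)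
    then show ?case by blast
  qed
  from this[of "Poly_Mapping.keys p" "Poly_Mapping.lookup p"] obtain A where A: "p = quad_poly V A"
    using assms(2,3) real_poly_eq_sum[of p] by (auto simp: carrier_poly_ring homogeneous_alt)
  \<comment> \<open>The matrix collected from the monomials need not be symmetric; averaging it with
    its transpose leaves the polynomial unchanged.\<close>
  define B where "B i j = A i j / 2 + A j i / 2" for i j
  have swap: "quad_poly V (\<lambda>i j. A j i / 2) = quad_poly V (\<lambda>i j. A i j / 2)"
    unfolding quad_poly_def by (subst sum.swap) (simp add: mult.commute)
  have "quad_poly V B = quad_poly V (\<lambda>i j. A i j / 2) + quad_poly V (\<lambda>i j. A i j / 2)"
    unfolding B_def quad_poly_add swap ..
  also have "\<dots> = p" unfolding A quad_poly_add[symmetric] by simp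
  finally have "p = quad_poly V B" ..
  moreover have "\<forall>i j. B i j = B j i" by (simp add: B_def)
  ultimately show ?thesis by blast
qed

section \<open>Residue classes as functions on the realization\<close>

locale simplicial_complex =
  fixes \<Delta> :: "'a set set"
  assumes fc: "finite_complex \<Delta>"
begin

abbreviation "V \<equiv> vertices \<Delta>"
abbreviation "P \<equiv> poly_ring (vertices \<Delta>)"
abbreviation "Q \<equiv> SR_ring \<Delta>"
abbreviation "I \<equiv> SR_ideal \<Delta>"
abbreviation "cl \<equiv> SR_class \<Delta>"

lemma finite_vertices: "finite V"
  using fc by (simp add: finite_complex_def)

lemma face_subset: "F \<in> \<Delta> \<Longrightarrow> G \<subseteq> F \<Longrightarrow> G \<in> \<Delta>"
  using fc by (simp add: finite_complex_def)

lemma face_subset_vertices: "F \<in> \<Delta> \<Longrightarrow> F \<subseteq> V"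
  unfolding vertices_def by blast

lemma singleton_face: "i \<in> V \<Longrightarrow> {i} \<in> \<Delta>"
  unfolding vertices_def using face_subset by blast

lemma generators_in_carrier:
  "{(\<Prod>i\<in>S. var_poly i) | S. S \<subseteq> V \<and> S \<notin> \<Delta>} \<subseteq> carrier P"
  by (auto intro!: poly_ring_prod)

lemma ideal_SR_ideal: "ideal I P"
proof -
  interpret cring P by (rule cring_poly_ring)
  show ?thesis unfolding SR_ideal_def by (rule genideal_ideal[OF generators_in_carrier])
qed

text \<open>This makes \<open>SR_eval\<close> independent of the representative. A nonface is not
  contained in the face supporting \<open>x\<close>, so one of its variables vanishes at
  \<open>x\<close>.\<close>

lemma eval_SR_ideal:
  assumes "p \<in> I" "x \<in> realization \<Delta>"
  shows "eval_poly x p = 0"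
proof -
  interpret cring P by (rule cring_poly_ring)
  have "eval_poly y (\<Prod>i\<in>S. var_poly i) = 0" if S: "S \<subseteq> V" "S \<notin> \<Delta>" "y \<in> realization \<Delta>" for S y
  proof -
    obtain F where F: "F \<in> \<Delta>" "y \<in> coord_span F" using S(3) by blast
    then obtain i where "i \<in> S" "i \<notin> F" using face_subset[OF F(1), of S] S(2) by blast
    moreover have "finite S" using S(1) finite_vertices finite_subset by blast
    ultimately show ?thesis using F(2) unfolding eval_poly_prod coord_span_def by auto
  qed
  then have "I \<subseteq> {p \<in> carrier P. \<forall>x\<in>realization \<Delta>. eval_poly x p = 0}"
    unfolding SR_ideal_def using generators_in_carrier
    by (intro genideal_minimal ideal_vanishing) blast
  then show ?thesis using assms by blast
qed

lemma SR_eval_class: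
  assumes "p \<in> carrier P" "x \<in> realization \<Delta>"
  shows "SR_eval (cl p) x = eval_poly x p"
proof -
  interpret ideal I P by (rule ideal_SR_ideal)
  have "cl p = (\<lambda>h. h + p) ` I"
    unfolding SR_class_def a_r_coset_def' by (auto simp: poly_ring_simps)
  moreover have "eval_poly x (h + p) = eval_poly x p" if "h \<in> I" for h
    using eval_SR_ideal[OF that assms(2)] by (simp add: eval_poly_add)
  ultimately have "eval_poly x ` cl p = (\<lambda>_. eval_poly x p) ` I"
    by (simp add: image_image)
  \<comment> \<open>The ideal contains 0, so the set of values on the coset is a singleton and not
    empty.\<close>
  then show ?thesis
    using additive_subgroup.zero_closed[OF is_additive_subgroup]
    by (simp add: SR_eval_def image_constant)
qed

lemma SR_class_hom:
  assumes "p \<in> carrier P" "q \<in> carrier P"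
  shows "cl (p + q) = cl p \<oplus>\<^bsub>Q\<^esub> cl q" "cl (p * q) = cl p \<otimes>\<^bsub>Q\<^esub> cl q"
  using ring_hom_add[OF ideal.rcos_ring_hom[OF ideal_SR_ideal] assms]
    ring_hom_mult[OF ideal.rcos_ring_hom[OF ideal_SR_ideal] assms]
  unfolding SR_class_def SR_ring_def by (simp_all add: poly_ring_simps)

lemma SR_class_carrier: "p \<in> carrier P \<Longrightarrow> cl p \<in> carrier Q"
  using ring_hom_closed[OF ideal.rcos_ring_hom[OF ideal_SR_ideal]]
  unfolding SR_class_def SR_ring_def by blast

lemma cring_SR_ring: "cring Q"
  unfolding SR_ring_def
  by (rule ideal.quotient_is_cring[OF ideal_SR_ideal cring_poly_ring])

lemma SR_class_zero: "cl 0 = \<zero>\<^bsub>Q\<^esub>"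
proof -
  interpret cring Q by (rule cring_SR_ring)
  have "cl 0 \<oplus>\<^bsub>Q\<^esub> cl 0 = cl 0" using SR_class_hom(1)[of 0 0] by simp
  then show ?thesis using SR_class_carrier[of 0] by (simp add: add.l_cancel_one)
qed

lemma SR_class_eqI:
  assumes "p \<in> carrier P" "q \<in> carrier P" "p - q \<in> I"
  shows "cl p = cl q"
proof -
  interpret ideal I P by (rule ideal_SR_ideal)
  have "p = (p - q) \<oplus>\<^bsub>P\<^esub> q" by (simp add: poly_ring_simps)
  then have "p \<in> cl q" unfolding SR_class_def a_r_coset_def' using assms(3) by blast
  then have "I +>\<^bsub>P\<^esub> q = I +>\<^bsub>P\<^esub> p"
    unfolding SR_class_def
    by (rule a_repr_independence[OF _ assms(2) additive_subgroup.a_subgroup[OF is_additive_subgroup]])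
  then show ?thesis unfolding SR_class_def ..
qed

lemma SR_part2_form:
  assumes "q \<in> SR_part 2 \<Delta>"
  obtains A where "\<And>i j. A i j = A j i" "q = cl (quad_poly V A)"
  using assms homogeneous_2_quad_poly[OF finite_vertices] unfolding SR_part_def by blast

lemma SR_part1_form:
  assumes "l \<in> SR_part 1 \<Delta>"
  obtains a where "l = cl (lin_poly V a)"
  using assms homogeneous_1_lin_poly[OF finite_vertices] unfolding SR_part_def by blast

lemma lin_class: "cl (lin_poly V a) \<in> SR_part 1 \<Delta>"
  unfolding SR_part_def using lin_poly_carrier homogeneous_lin_poly by blast

lemma quad_class: "cl (quad_poly V A) \<in> SR_part 2 \<Delta>"
  unfolding SR_part_def using quad_poly_carrier homogeneous_quad_poly by blast

lemma SR_part2_eval: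
  assumes "q \<in> SR_part 2 \<Delta>"
  obtains A where "\<And>i j. A i j = A j i" "\<And>x. x \<in> realization \<Delta> \<Longrightarrow> SR_eval q x = quad V A x"
  by (rule SR_part2_form[OF assms]) (metis SR_eval_class quad_poly_carrier eval_quad_poly)

lemma quad_class_eval: "x \<in> realization \<Delta> \<Longrightarrow> SR_eval (cl (quad_poly V A)) x = quad V A x"
  by (simp only: SR_eval_class quad_poly_carrier eval_quad_poly)

lemma SR_part_carrier: "q \<in> SR_part d \<Delta> \<Longrightarrow> q \<in> carrier Q"
  unfolding SR_part_def using SR_class_carrier by blast

text \<open>A class of degree two is determined by its function. In the difference of two
  coefficient matrices, entries over faces are read off from values, and the monomials over nonfaces
  are generators of the ideal.\<close>

lemma SR_part2_eqI:
  assumes "p \<in> SR_part 2 \<Delta>" "q \<in> SR_part 2 \<Delta>"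
    and eq: "\<And>x. x \<in> realization \<Delta> \<Longrightarrow> SR_eval p x = SR_eval q x"
  shows "p = q"
proof -
  obtain A where A: "\<And>i j. A i j = A j i" "p = cl (quad_poly V A)"
    by (rule SR_part2_form[OF assms(1)]) (rule that)
  obtain B where B: "\<And>i j. B i j = B j i" "q = cl (quad_poly V B)"
    by (rule SR_part2_form[OF assms(2)]) (rule that)
  define C where "C i j = A i j - B i j" for i j
  have C: "quad_poly V A = quad_poly V C + quad_poly V B"
    unfolding quad_poly_add[symmetric] C_def by simp
  have Csym: "\<And>i j. C i j = C j i" unfolding C_def using A(1) B(1) by metis
  have vanish: "quad V C x = 0" if "x \<in> realization \<Delta>" for x
    using eq[OF that] quad_class_eval[OF that] C
    by (metis A(2) B(2) add_cancel_left_left eval_poly_add eval_quad_poly)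
  have face: "C i j = 0" if ij: "{i, j} \<in> \<Delta>" for i j
  proof -
    have V: "i \<in> V" "j \<in> V" using face_subset_vertices[OF ij] by auto
    let ?e = "\<lambda>k n. of_bool (n = k) :: real"
    \<comment> \<open>Polarisation at \<open>e_i + t e_j\<close>, a point supported on the face; the
      values at \<open>t = 0, 1, -1\<close> isolate the entry. The case \<open>i = j\<close> gives
      the diagonal.\<close>
    have "quad V C (\<lambda>n. ?e i n + t * ?e j n) = 0" for t
      by (rule vanish) (use ij in \<open>auto simp: coord_span_def intro!: bexI[of _ "{i, j}"]\<close>)
    then have "quad V C (?e i) + 2 * t * bil V C (?e i) (?e j) + t\<^sup>2 * quad V C (?e j) = 0" for t
      by (simp only: quad_add_scale[OF Csym])
    from this[of 0] this[of 1] this[of "-1"] have "bil V C (?e i) (?e j) = 0" by simp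
    then show ?thesis
      using V finite_vertices by (simp only: bil_indicator sum_indicator)
  qed
  interpret I: ideal I P by (rule ideal_SR_ideal)
  have zero: "0 \<in> I"
    using additive_subgroup.zero_closed[OF I.is_additive_subgroup] by (simp add: poly_ring_simps)
  have sum_in_I: "(\<Sum>i\<in>K. f i) \<in> I" if "\<And>i. i \<in> K \<Longrightarrow> f i \<in> I" for K :: "'a set" and f
    using that
  proof (induction K rule: infinite_finite_induct)
    case (insert i K)
    then show ?case using additive_subgroup.a_closed[OF I.is_additive_subgroup, of "f i" "sum f K"]
      by (simp add: poly_ring_simps)
  qed (simp_all add: zero)
  have term_in_I: "const_poly (C i j) * (var_poly i * var_poly j) \<in> I" if ij: "i \<in> V" "j \<in> V" for i j
  proof (cases "{i, j} \<in> \<Delta>")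
    case True
    then show ?thesis using face zero by simp
  next
    case False
    \<comment> \<open>Singletons are faces, so a nonface here has two elements and its squarefree
      generator is the monomial wanted.\<close>
    then have "i \<noteq> j" using singleton_face ij by auto
    then have "(\<Prod>k\<in>{i, j}. var_poly k) = var_poly i * var_poly j" by simp
    moreover have "(\<Prod>k\<in>{i, j}. var_poly k) \<in> I"
      unfolding SR_ideal_def using False ij
      by (intro subsetD[OF I.genideal_self[OF generators_in_carrier]]) blast
    ultimately show ?thesis
      using I.I_l_closed[of _ "const_poly (C i j)"] by (simp add: poly_ring_simps)
  qed
  have "quad_poly V C \<in> I" unfolding quad_poly_def by (intro sum_in_I term_in_I)
  then show ?thesis
    unfolding A(2) B(2) using C by (intro SR_class_eqI quad_poly_carrier) simp
qed

lemma SR_zero: "\<zero>\<^bsub>Q\<^esub> \<in> SR_part 2 \<Delta>"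
  "x \<in> realization \<Delta> \<Longrightarrow> SR_eval \<zero>\<^bsub>Q\<^esub> x = 0"
  using SR_class_zero SR_eval_class[of 0 x] homogeneous_zero[of 2] unfolding SR_part_def
  by (auto intro!: exI[of _ "0"])

lemma SR_add:
  assumes "p \<in> SR_part 2 \<Delta>" "q \<in> SR_part 2 \<Delta>"
  shows "p \<oplus>\<^bsub>Q\<^esub> q \<in> SR_part 2 \<Delta>"
    and "x \<in> realization \<Delta> \<Longrightarrow> SR_eval (p \<oplus>\<^bsub>Q\<^esub> q) x = SR_eval p x + SR_eval q x"
proof -
  obtain f g where fg: "f \<in> carrier P" "g \<in> carrier P" "homogeneous 2 f" "homogeneous 2 g"
    "p = cl f" "q = cl g" using assms unfolding SR_part_def by blast
  have "p \<oplus>\<^bsub>Q\<^esub> q = cl (f + g)" using fg SR_class_hom by simp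
  then show "p \<oplus>\<^bsub>Q\<^esub> q \<in> SR_part 2 \<Delta>"
    "x \<in> realization \<Delta> \<Longrightarrow> SR_eval (p \<oplus>\<^bsub>Q\<^esub> q) x = SR_eval p x + SR_eval q x"
    using fg homogeneous_add poly_ring_add unfolding SR_part_def
    by (blast, simp add: SR_eval_class poly_ring_add eval_poly_add)
qed

lemma SR_scale:
  assumes "q \<in> SR_part 2 \<Delta>"
  shows "SR_scale \<Delta> c q \<in> SR_part 2 \<Delta>"
    and "x \<in> realization \<Delta> \<Longrightarrow> SR_eval (SR_scale \<Delta> c q) x = c * SR_eval q x"
proof -
  obtain f where f: "f \<in> carrier P" "homogeneous 2 f" "q = cl f"
    using assms unfolding SR_part_def by blast
  have s: "SR_scale \<Delta> c q = cl (const_poly c * f)"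
    unfolding SR_scale_def using f SR_class_hom(2)[of "const_poly c" f] by simp
  have "const_poly c * f \<in> carrier P" using f by (simp add: poly_ring_mult)
  moreover have "homogeneous 2 (const_poly c * f)"
    using homogeneous_mult[OF homogeneous_const f(2), of c] by (simp only: add_0)
  ultimately show "SR_scale \<Delta> c q \<in> SR_part 2 \<Delta>"
    "x \<in> realization \<Delta> \<Longrightarrow> SR_eval (SR_scale \<Delta> c q) x = c * SR_eval q x"
    unfolding s using f SR_part_def by (blast, simp add: SR_eval_class eval_poly_mult)
qed

lemma SR_square_lin:
  fixes a :: "'a \<Rightarrow> real"
  defines "l \<equiv> cl (lin_poly V a)"
  shows "l \<otimes>\<^bsub>Q\<^esub> l \<in> SR_part 2 \<Delta>"
    and "x \<in> realization \<Delta> \<Longrightarrow> SR_eval (l \<otimes>\<^bsub>Q\<^esub> l) x = (\<Sum>i\<in>V. a i * x i)\<^sup>2"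
proof -
  let ?f = "lin_poly V a"
  have s: "l \<otimes>\<^bsub>Q\<^esub> l = cl (?f * ?f)"
    unfolding l_def using SR_class_hom(2)[OF lin_poly_carrier lin_poly_carrier] by simp
  have "?f * ?f \<in> carrier P" by (intro poly_ring_mult lin_poly_carrier)
  moreover have "homogeneous 2 (?f * ?f)"
    using homogeneous_mult[OF homogeneous_lin_poly homogeneous_lin_poly, of V a V a]
    by (simp add: numeral_2_eq_2)
  ultimately show "l \<otimes>\<^bsub>Q\<^esub> l \<in> SR_part 2 \<Delta>"
    "x \<in> realization \<Delta> \<Longrightarrow> SR_eval (l \<otimes>\<^bsub>Q\<^esub> l) x = (\<Sum>i\<in>V. a i * x i)\<^sup>2"
    unfolding s SR_part_def
    by (blast, simp add: SR_eval_class eval_poly_mult eval_lin_poly power2_eq_square)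
qed

lemma SR_finsum:
  assumes "\<And>j. j < (k :: nat) \<Longrightarrow> f j \<in> SR_part 2 \<Delta>"
  shows "(\<Oplus>\<^bsub>Q\<^esub>j\<in>{..<k}. f j) \<in> SR_part 2 \<Delta> \<and>
    (\<forall>x\<in>realization \<Delta>. SR_eval (\<Oplus>\<^bsub>Q\<^esub>j\<in>{..<k}. f j) x = (\<Sum>j<k. SR_eval (f j) x))"
  using assms
proof (induction k)
  case 0
  interpret cring Q by (rule cring_SR_ring)
  show ?case using SR_zero by simp
next
  case (Suc k)
  interpret cring Q by (rule cring_SR_ring)
  have "f j \<in> carrier Q" if "j < Suc k" for j using Suc.prems that SR_part_carrier by blast
  then have "(\<Oplus>\<^bsub>Q\<^esub>j\<in>{..<Suc k}. f j) = f k \<oplus>\<^bsub>Q\<^esub> (\<Oplus>\<^bsub>Q\<^esub>j\<in>{..<k}. f j)"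
    unfolding lessThan_Suc by (intro finsum_insert) auto
  then show ?case using Suc SR_add by simp
qed

text \<open>The passage from squares in the quotient ring to squares of functions; the direction
  back uses that the function determines the class.\<close>

lemma sos_cone_iff:
  assumes "q \<in> SR_part 2 \<Delta>"
  shows "q \<in> sos_cone \<Delta> \<longleftrightarrow>
    (\<exists>(k :: nat) a. \<forall>x\<in>realization \<Delta>. SR_eval q x = (\<Sum>j<k. (\<Sum>i\<in>V. a j i * x i)\<^sup>2))"
proof
  assume "q \<in> sos_cone \<Delta>"
  then obtain k :: nat and l where q: "q = (\<Oplus>\<^bsub>Q\<^esub>j\<in>{..<k}. l j \<otimes>\<^bsub>Q\<^esub> l j)"
    and l: "\<And>j. j < k \<Longrightarrow> l j \<in> SR_part 1 \<Delta>"
    unfolding sos_cone_def by blast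
  have "\<exists>a. l j = cl (lin_poly V a)" if "j < k" for j
    using l[OF that] SR_part1_form by blast
  then obtain a where a: "\<And>j. j < k \<Longrightarrow> l j = cl (lin_poly V (a j))" by metis
  have "l j \<otimes>\<^bsub>Q\<^esub> l j \<in> SR_part 2 \<Delta>" if "j < k" for j
    using SR_square_lin(1) a that by simp
  note f = SR_finsum[of k "\<lambda>j. l j \<otimes>\<^bsub>Q\<^esub> l j", OF this]
  have "SR_eval q x = (\<Sum>j<k. (\<Sum>i\<in>V. a j i * x i)\<^sup>2)" if x: "x \<in> realization \<Delta>" for x
  proof -
    have "SR_eval q x = (\<Sum>j<k. SR_eval (l j \<otimes>\<^bsub>Q\<^esub> l j) x)" unfolding q using f x by blast
    also have "\<dots> = (\<Sum>j<k. (\<Sum>i\<in>V. a j i * x i)\<^sup>2)"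
      using SR_square_lin(2)[OF x] a by (intro sum.cong refl) simp
    finally show ?thesis .
  qed
  then show "\<exists>(k :: nat) a. \<forall>x\<in>realization \<Delta>. SR_eval q x = (\<Sum>j<k. (\<Sum>i\<in>V. a j i * x i)\<^sup>2)"
    by blast
next
  assume "\<exists>(k :: nat) a. \<forall>x\<in>realization \<Delta>. SR_eval q x = (\<Sum>j<k. (\<Sum>i\<in>V. a j i * x i)\<^sup>2)"
  then obtain k :: nat and a
    where a: "\<And>x. x \<in> realization \<Delta> \<Longrightarrow> SR_eval q x = (\<Sum>j<k. (\<Sum>i\<in>V. a j i * x i)\<^sup>2)"
    by blast
  define l where "l j = cl (lin_poly V (a j))" for j
  have "l j \<otimes>\<^bsub>Q\<^esub> l j \<in> SR_part 2 \<Delta>" for j unfolding l_def by (rule SR_square_lin(1))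
  note f = SR_finsum[of k "\<lambda>j. l j \<otimes>\<^bsub>Q\<^esub> l j", OF this]
  have "q = (\<Oplus>\<^bsub>Q\<^esub>j\<in>{..<k}. l j \<otimes>\<^bsub>Q\<^esub> l j)"
  proof (rule SR_part2_eqI[OF assms])
    show "(\<Oplus>\<^bsub>Q\<^esub>j\<in>{..<k}. l j \<otimes>\<^bsub>Q\<^esub> l j) \<in> SR_part 2 \<Delta>" using f ..
    fix x assume x: "x \<in> realization \<Delta>"
    then have "SR_eval (\<Oplus>\<^bsub>Q\<^esub>j\<in>{..<k}. l j \<otimes>\<^bsub>Q\<^esub> l j) x = (\<Sum>j<k. SR_eval (l j \<otimes>\<^bsub>Q\<^esub> l j) x)"
      using f by blast
    also have "\<dots> = SR_eval q x" unfolding a[OF x] l_def SR_square_lin(2)[OF x] ..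
    finally show "SR_eval q x = SR_eval (\<Oplus>\<^bsub>Q\<^esub>j\<in>{..<k}. l j \<otimes>\<^bsub>Q\<^esub> l j) x" ..
  qed
  moreover have "l j \<in> SR_part 1 \<Delta>" for j unfolding l_def by (rule lin_class)
  ultimately show "q \<in> sos_cone \<Delta>"
    unfolding sos_cone_def by (intro CollectI exI[of _ k] exI[of _ l]) simp
qed

lemma nonneg_cone_iff:
  "q \<in> nonneg_cone \<Delta> \<longleftrightarrow> q \<in> SR_part 2 \<Delta> \<and> (\<forall>x\<in>realization \<Delta>. 0 \<le> SR_eval q x)"
  by (auto simp: nonneg_cone_def)

lemma SR_independent_iff:
  assumes "y \<in> SR_part 2 \<Delta>" "z \<in> SR_part 2 \<Delta>"
  shows "SR_independent \<Delta> y z \<longleftrightarrow>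
    (\<forall>a b. (\<forall>x\<in>realization \<Delta>. a * SR_eval y x + b * SR_eval z x = 0) \<longrightarrow> a = 0 \<and> b = 0)"
proof -
  have "SR_scale \<Delta> a y \<oplus>\<^bsub>Q\<^esub> SR_scale \<Delta> b z = \<zero>\<^bsub>Q\<^esub> \<longleftrightarrow>
      (\<forall>x\<in>realization \<Delta>. a * SR_eval y x + b * SR_eval z x = 0)" for a b
  proof -
    let ?w = "SR_scale \<Delta> a y \<oplus>\<^bsub>Q\<^esub> SR_scale \<Delta> b z"
    have "?w \<in> SR_part 2 \<Delta>" by (intro SR_add(1) SR_scale(1) assms)
    from SR_part2_eqI[OF this SR_zero(1)]
    have "?w = \<zero>\<^bsub>Q\<^esub> \<longleftrightarrow> (\<forall>x\<in>realization \<Delta>. SR_eval ?w x = 0)"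
      using SR_zero(2) by metis
    then show ?thesis using SR_scale SR_add assms by simp
  qed
  then show ?thesis unfolding SR_independent_def by simp
qed

text \<open>The minimum in \<open>form_rank\<close> is attained, since diagonalisation on
  \<open>F\<close> supplies a first decomposition, with \<open>card F\<close> squares.\<close>

lemma form_rank_properties:
  assumes q: "q \<in> nonneg_cone \<Delta>" and F: "F \<in> \<Delta>"
  shows "\<exists>a. \<forall>x\<in>coord_span F. SR_eval q x = (\<Sum>j<form_rank F (SR_eval q). (\<Sum>i\<in>F. a j i * x i)\<^sup>2)"
    and "form_rank F (SR_eval q) \<le> card F"
proof -
  obtain A where A: "\<And>i j. A i j = A j i" "\<And>x. x \<in> realization \<Delta> \<Longrightarrow> SR_eval q x = quad V A x"
    by (rule SR_part2_eval[of q]) (use q nonneg_cone_iff that in auto)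
  have real: "x \<in> realization \<Delta>" if "x \<in> coord_span F" for x using that F by blast
  have F': "finite F" "F \<subseteq> V" using face_subset_vertices[OF F] finite_vertices finite_subset by auto
  have eq: "SR_eval q x = quad F A x" if "x \<in> coord_span F" for x
    using A(2)[OF real[OF that]] quad_coord_span[OF finite_vertices F'(2) that] by simp
  have "0 \<le> quad F A x" if "x \<in> coord_span F" for x
    using eq[OF that] q real[OF that] unfolding nonneg_cone_iff by metis
  from quad_sum_squares[OF F'(1) A(1) this]
  have ex: "\<exists>a. \<forall>x\<in>coord_span F. SR_eval q x = (\<Sum>j<card F. (\<Sum>i\<in>F. a j i * x i)\<^sup>2)"
    using eq by simp
  show "form_rank F (SR_eval q) \<le> card F"
    unfolding form_rank_def by (rule Least_le) (rule ex)
  show "\<exists>a. \<forall>x\<in>coord_span F. SR_eval q x = (\<Sum>j<form_rank F (SR_eval q). (\<Sum>i\<in>F. a j i * x i)\<^sup>2)"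
    unfolding form_rank_def by (rule LeastI) (rule ex)
qed

lemma finite_faces: "finite \<Delta>"
  by (rule finite_subset[of _ "Pow V"]) (use face_subset_vertices finite_vertices in auto)

lemma form_rank_le_local_rank: "F \<in> \<Delta> \<Longrightarrow> form_rank F (SR_eval q) \<le> local_rank \<Delta> q"
  unfolding local_rank_def using finite_faces by (intro Max_ge) auto

lemma local_rank_attained:
  assumes "\<Delta> \<noteq> {}"
  obtains F where "F \<in> \<Delta>" "local_rank \<Delta> q = form_rank F (SR_eval q)"
proof -
  have "local_rank \<Delta> q \<in> (\<lambda>F. form_rank F (SR_eval q)) ` \<Delta>"
    unfolding local_rank_def using finite_faces assms by (intro Max_in) auto
  then show ?thesis using that by blast
qed

text \<open>Keeps the set in \<open>elocr\<close> bounded, without which its supremum over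
  \<open>nat\<close> would be no maximum.\<close>

lemma local_rank_le_card:
  assumes "\<Delta> \<noteq> {}" "q \<in> nonneg_cone \<Delta>"
  shows "local_rank \<Delta> q \<le> card V"
  using local_rank_attained[OF assms(1), of q] form_rank_properties(2)[OF assms(2)]
    face_subset_vertices finite_vertices by (metis card_mono le_trans)

end

section \<open>Pulling back forms along strongly connected maps\<close>

text \<open>The linear map taking \<open>e_i\<close> to \<open>e_(\<phi> i)\<close>, in coordinates;
  a finite \<open>V\<close> keeps the fibre sums finite.\<close>

definition push :: "'a set \<Rightarrow> ('a \<Rightarrow> 'b) \<Rightarrow> ('a \<Rightarrow> real) \<Rightarrow> 'b \<Rightarrow> real" where
  "push V \<phi> x c = (\<Sum>i\<in>{i \<in> V. \<phi> i = c}. x i)"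

text \<open>Sorting the vertices by fibre gives the adjoint of \<open>push\<close>, which composes
  coefficients with \<open>\<phi>\<close>; applying it in each argument yields
  \<open>quad_push\<close>.\<close>

lemma linear_push:
  assumes "finite V" "finite W" "\<phi> ` V \<subseteq> W"
  shows "(\<Sum>c\<in>W. f c * push V \<phi> x c) = (\<Sum>i\<in>V. f (\<phi> i) * x i)"
proof -
  have "f c * push V \<phi> x c = (\<Sum>i\<in>{i \<in> V. \<phi> i = c}. f (\<phi> i) * x i)" for c
    unfolding push_def sum_distrib_left by (intro sum.cong) auto
  then show ?thesis using sum.group[OF assms, of "\<lambda>i. f (\<phi> i) * x i"] by simp
qed

lemma quad_push:
  assumes "finite V" "finite W" "\<phi> ` V \<subseteq> W"
  shows "quad W A (push V \<phi> x) = quad V (\<lambda>i j. A (\<phi> i) (\<phi> j)) x"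
proof -
  have "quad W A (push V \<phi> x) =
      (\<Sum>c\<in>W. (\<Sum>d\<in>W. A c d * push V \<phi> x d) * push V \<phi> x c)"
    unfolding quad_def sum_distrib_right by (intro sum.cong refl) (simp add: mult.commute mult.left_commute)
  also have "\<dots> = (\<Sum>i\<in>V. (\<Sum>d\<in>W. A (\<phi> i) d * push V \<phi> x d) * x i)"
    by (rule linear_push[OF assms])
  also have "\<dots> = quad V (\<lambda>i j. A (\<phi> i) (\<phi> j)) x"
    unfolding linear_push[OF assms] quad_def sum_distrib_right
    by (intro sum.cong refl) (simp add: mult.commute mult.left_commute)
  finally show ?thesis .
qed

lemma push_coord_span:
  assumes "x \<in> coord_span T"
  shows "push V \<phi> x \<in> coord_span (\<phi> ` T)"
  using assms unfolding coord_span_def push_def by (auto intro!: sum.neutral)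

text \<open>The section \<open>s\<close> places each coordinate of \<open>x\<close> on one vertex of
  its fibre, so all other terms of the fibre sum are zero.\<close>

lemma push_section:
  assumes s: "\<And>c. c \<in> F \<Longrightarrow> s c \<in> T \<and> \<phi> (s c) = c" and T: "T \<subseteq> V" "finite V"
    and x: "x \<in> coord_span F"
  defines "y \<equiv> (\<lambda>i. if i \<in> s ` F then x (\<phi> i) else 0)"
  shows "y \<in> coord_span T" "push V \<phi> y = x"
proof -
  show "y \<in> coord_span T" using s unfolding y_def coord_span_def by auto
  show "push V \<phi> y = x"
  proof
    fix c
    show "push V \<phi> y c = x c"
    proof (cases "c \<in> F")
      case True
      have "push V \<phi> y c = (\<Sum>i\<in>{s c}. y i)"
        unfolding push_def
        using True s T by (intro sum.mono_neutral_right) (auto simp: y_def)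
      then show ?thesis using True s by (simp add: y_def)
    next
      case False
      then show ?thesis using s x unfolding push_def coord_span_def y_def
        by (auto intro!: sum.neutral)
    qed
  qed
qed

section \<open>Descent of forms, and transfer of extreme rays and ranks\<close>

locale strong_map = D: simplicial_complex \<Delta> + G: simplicial_complex \<Gamma>
  for \<Delta> :: "'a set set" and \<Gamma> :: "'b set set" +
  fixes \<phi> :: "'a \<Rightarrow> 'b"
  assumes strong: "strongly_connected_map \<Delta> \<Gamma> \<phi>"
begin

abbreviation "p \<equiv> push (vertices \<Delta>) \<phi>"

lemma vertex_image: "\<phi> ` vertices \<Delta> \<subseteq> vertices \<Gamma>"
  and face_image: "T \<in> \<Delta> \<Longrightarrow> \<phi> ` T \<in> \<Gamma>"
  and face_lift: "F \<in> \<Gamma> \<Longrightarrow> \<exists>T\<in>\<Delta>. \<phi> ` T = F"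
  using strong
  unfolding strongly_connected_map_def surjective_simplicial_map_def simplicial_map_def by auto

lemmas linear_push = linear_push[OF D.finite_vertices G.finite_vertices vertex_image]
lemmas quad_push = quad_push[OF D.finite_vertices G.finite_vertices vertex_image]

lemma push_realization: "x \<in> realization \<Delta> \<Longrightarrow> p x \<in> realization \<Gamma>"
  using push_coord_span face_image by blast

text \<open>Lifting of faces turns into surjectivity of \<open>p\<close> on realizations, so
  identities and inequalities on \<Gamma> may be checked after pulling back.\<close>

lemma realization_lift:
  assumes "x \<in> realization \<Gamma>"
  obtains y where "y \<in> realization \<Delta>" "p y = x"
proof -
  obtain F where F: "F \<in> \<Gamma>" "x \<in> coord_span F" using assms by blast
  obtain T where T: "T \<in> \<Delta>" "\<phi> ` T = F" using face_lift F by blast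
  have "\<forall>c\<in>F. \<exists>i. i \<in> T \<and> \<phi> i = c" using T(2) by blast
  then obtain s where s: "\<And>c. c \<in> F \<Longrightarrow> s c \<in> T \<and> \<phi> (s c) = c" by metis
  show ?thesis
    using push_section[OF s D.face_subset_vertices[OF T(1)] D.finite_vertices F(2)] T(1) that by blast
qed

lemma fibre_connected:
  assumes "a \<in> vertices \<Delta>" "b \<in> vertices \<Delta>" "\<phi> a = \<phi> b"
  shows "(a, b) \<in> {(x, y). {x, y} \<in> \<Delta> \<and> \<phi> x = \<phi> y}\<^sup>*"
proof -
  have "\<phi> a \<in> vertices \<Gamma>" using assms vertex_image by blast
  then obtain k x where k: "k \<ge> (1::nat)" "x 1 = a" "x k = b"
    and x: "\<And>i. i \<in> {1..k} \<Longrightarrow> \<phi> (x i) = \<phi> a" "\<And>i. i \<in> {1..<k} \<Longrightarrow> {x i, x (i + 1)} \<in> \<Delta>"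
    using strong assms unfolding strongly_connected_map_def by metis
  have "i \<le> k \<Longrightarrow> (a, x i) \<in> {(x, y). {x, y} \<in> \<Delta> \<and> \<phi> x = \<phi> y}\<^sup>*" if "i \<ge> 1" for i
    using that
  proof (induction i rule: dec_induct)
    case base
    then show ?case using k by simp
  next
    case (step n)
    then have "(x n, x (Suc n)) \<in> {(x, y). {x, y} \<in> \<Delta> \<and> \<phi> x = \<phi> y}"
      using x(1)[of n] x(1)[of "Suc n"] x(2)[of n] by simp
    then show ?case using step by (meson Suc_leD rtrancl.rtrancl_into_rtrancl)
  qed
  then show ?thesis using k by blast
qed

lemma fibre_invariant:
  assumes "\<And>a b. {a, b} \<in> \<Delta> \<Longrightarrow> \<phi> a = \<phi> b \<Longrightarrow> f a = f b"
    and "a \<in> vertices \<Delta>" "b \<in> vertices \<Delta>" "\<phi> a = \<phi> b"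
  shows "f a = f b"
  using fibre_connected[OF assms(2-)] assms(1)
  by (induction rule: rtrancl_induct) auto

text \<open>\<open>Y\<close> will be the coefficient matrix of a summand, with \<open>step\<close>
  coming from its kernel. Over a genuine edge of \<Gamma> the second connectivity condition moves
  between edges of \<Delta>. Over a vertex, entries on a collapsed edge reduce to diagonal ones, and
  the first condition moves between vertices.\<close>

lemma edge_fibre_invariant:
  assumes step: "\<And>a b c. {a, b, c} \<in> \<Delta> \<Longrightarrow> \<phi> a = \<phi> b \<Longrightarrow> Y a c = Y b c"
    and sym: "\<And>a b. Y a b = Y b a"
    and ab: "{a, b} \<in> \<Delta>" "{a', b'} \<in> \<Delta>" "\<phi> a = \<phi> a'" "\<phi> b = \<phi> b'"
  shows "Y a b = (Y a' b' :: real)"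
proof (cases "\<phi> a = \<phi> b")
  case True
  \<comment> \<open>Here \<open>step\<close> is used with a repeated vertex, the face being just the
    collapsed edge.\<close>
  have diag: "Y u v = Y u u" if "{u, v} \<in> \<Delta>" "\<phi> u = \<phi> v" for u v
    using step[of v u u] that sym[of u v] by (simp add: insert_commute)
  have V: "a \<in> vertices \<Delta>" "a' \<in> vertices \<Delta>"
    using D.face_subset_vertices[OF ab(1)] D.face_subset_vertices[OF ab(2)] by auto
  have "Y a a = Y a' a'"
  proof (rule fibre_invariant[where f = "\<lambda>u. Y u u"])
    show "Y u u = Y v v" if "{u, v} \<in> \<Delta>" "\<phi> u = \<phi> v" for u v
      using diag[OF that] diag[of v u] that sym[of u v] by (simp add: insert_commute)
  qed (rule V ab)+
  then show ?thesis using diag[of a b] diag[of a' b'] ab True by simp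
next
  case False
  have "a \<noteq> b" "a' \<noteq> b'" using False ab by metis+
  then have "card {a, b} = 2" "card {a', b'} = 2" "card {\<phi> a, \<phi> b} = 2" using False by auto
  then have E: "{a, b} \<in> edges \<Delta>" "{a', b'} \<in> edges \<Delta>" "{\<phi> a, \<phi> b} \<in> edges \<Gamma>"
    "\<phi> ` {a, b} = {\<phi> a, \<phi> b}" "\<phi> ` {a', b'} = {\<phi> a, \<phi> b}"
    using ab face_image[OF ab(1)] by (auto simp: edges_def)
  note edge_paths = conjunct2[OF conjunct2[OF strong[unfolded strongly_connected_map_def]], rule_format]
  obtain k e where k: "k \<ge> (1::nat)" "e 1 = {a, b}" "e k = {a', b'}"
    and e: "\<And>i. i \<in> {1..k} \<Longrightarrow> e i \<in> edges \<Delta> \<and> \<phi> ` e i = {\<phi> a, \<phi> b}"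
      "\<And>i. i \<in> {1..<k} \<Longrightarrow> e i \<union> e (i + 1) \<in> \<Delta> \<and> e i \<inter> e (i + 1) \<noteq> {}"
    using edge_paths[OF E(1-3) conjI[OF E(4,5)]] by blast
  have pair: "\<exists>u v. e i = {u, v} \<and> \<phi> u = \<phi> a \<and> \<phi> v = \<phi> b" if "i \<in> {1..k}" for i
  proof -
    have "card (e i) = 2" "\<phi> ` e i = {\<phi> a, \<phi> b}" using e(1)[OF that] by (auto simp: edges_def)
    then obtain u v where uv: "e i = {u, v}" by (meson card_2_iff)
    then have "{\<phi> u, \<phi> v} = {\<phi> a, \<phi> b}" using \<open>\<phi> ` e i = {\<phi> a, \<phi> b}\<close> by simp
    then show ?thesis using uv unfolding doubleton_eq_iff by (metis insert_commute)
  qed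
  \<comment> \<open>The edges in the sequence are unordered, so the invariant speaks about every
    naming that puts \<open>u\<close> over \<open>\<phi> a\<close> and \<open>v\<close> over
    \<open>\<phi> b\<close>.\<close>
  have chain: "i \<le> k \<Longrightarrow> \<forall>u v. e i = {u, v} \<and> \<phi> u = \<phi> a \<and> \<phi> v = \<phi> b \<longrightarrow> Y u v = Y a b" if "i \<ge> 1" for i
    using that
  proof (induction i rule: dec_induct)
    case base
    then show ?case using k False by (auto simp: doubleton_eq_iff)
  next
    case (step n)
    then have n: "n \<in> {1..k}" "n \<in> {1..<k}" by auto
    obtain u v where uv: "e n = {u, v}" "\<phi> u = \<phi> a" "\<phi> v = \<phi> b" using pair[OF n(1)] by blast
    show ?case
    proof (intro allI impI, elim conjE)
      fix u' v' assume uv': "e (Suc n) = {u', v'}" "\<phi> u' = \<phi> a" "\<phi> v' = \<phi> b"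
      have un: "{u, v} \<union> {u', v'} \<in> \<Delta>" and "{u, v} \<inter> {u', v'} \<noteq> {}"
        using e(2)[OF n(2)] uv uv' by auto
      \<comment> \<open>The images \<open>\<phi> a\<close> and \<open>\<phi> b\<close> differ, so a
        shared vertex has the same role in both edges; the other two endpoints lie in a face with
        it, as \<open>step\<close> requires.\<close>
      then consider "u = u'" | "v = v'" using uv uv' False by auto
      then have "Y u' v' = Y u v"
      proof cases
        case 1
        then have "{v, v', u} \<in> \<Delta>" using un by (simp add: insert_commute)
        then show ?thesis using assms(1)[of v v' u] 1 uv uv' sym by metis
      next
        case 2
        then have "{u, u', v} \<in> \<Delta>" using un by (simp add: insert_commute)
        then show ?thesis using assms(1)[of u u' v] 2 uv uv' by metis
      qed
      then show "Y u' v' = Y a b" using step uv by simp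
    qed
  qed
  have "Y a' b' = Y a b" using chain[OF k(1) order.refl] k(3) ab by simp
  then show ?thesis ..
qed

text \<open>Specified by its values, which determine a class of degree two by
  \<open>SR_part2_eqI\<close>; existence for \<open>q\<close> of degree two comes from the matrix
  with entries \<open>A (\<phi> i) (\<phi> j)\<close>.\<close>

definition pullback :: "'b real_poly set \<Rightarrow> 'a real_poly set" where
  "pullback q = (SOME r. r \<in> SR_part 2 \<Delta> \<and> (\<forall>x\<in>realization \<Delta>. SR_eval r x = SR_eval q (p x)))"

lemma pullback:
  assumes "q \<in> SR_part 2 \<Gamma>"
  shows "pullback q \<in> SR_part 2 \<Delta>"
    and "x \<in> realization \<Delta> \<Longrightarrow> SR_eval (pullback q) x = SR_eval q (p x)"
proof -
  obtain A where A: "\<And>x. x \<in> realization \<Gamma> \<Longrightarrow> SR_eval q x = quad (vertices \<Gamma>) A x"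
    by (rule G.SR_part2_eval[OF assms]) (rule that)
  let ?B = "\<lambda>i j. A (\<phi> i) (\<phi> j)"
  have "\<exists>r. r \<in> SR_part 2 \<Delta> \<and> (\<forall>x\<in>realization \<Delta>. SR_eval r x = SR_eval q (p x))"
    using D.quad_class[of ?B] D.quad_class_eval[of _ ?B] A push_realization quad_push by auto
  from someI_ex[OF this, folded pullback_def]
  show "pullback q \<in> SR_part 2 \<Delta>"
    "x \<in> realization \<Delta> \<Longrightarrow> SR_eval (pullback q) x = SR_eval q (p x)" by auto
qed

lemma pullback_nonneg: "q \<in> nonneg_cone \<Gamma> \<Longrightarrow> pullback q \<in> nonneg_cone \<Delta>"
  unfolding D.nonneg_cone_iff G.nonneg_cone_iff using pullback push_realization by metis

definition collapsed :: "'a \<Rightarrow> 'a \<Rightarrow> 'a \<Rightarrow> real" where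
  "collapsed a b = (\<lambda>i. of_bool (i = a) - of_bool (i = b))"

lemma collapsed_realization: "{a, b} \<in> \<Delta> \<Longrightarrow> collapsed a b \<in> realization \<Delta>"
  by (auto simp: collapsed_def coord_span_def intro!: bexI[of _ "{a, b}"])

lemma push_collapsed:
  assumes "{a, b} \<in> \<Delta>" "\<phi> a = \<phi> b"
  shows "p (collapsed a b) = (\<lambda>_. 0)"
proof
  fix c
  have "a \<in> vertices \<Delta>" "b \<in> vertices \<Delta>" using assms D.face_subset_vertices by blast+
  moreover have "finite {i \<in> vertices \<Delta>. \<phi> i = c}" using D.finite_vertices by simp
  ultimately show "p (collapsed a b) c = 0"
    using assms sum_indicator[of "{i \<in> vertices \<Delta>. \<phi> i = c}" _ "\<lambda>_. 1"]
    unfolding push_def collapsed_def sum_subtractf by (cases "\<phi> a = c") (auto intro!: sum.neutral)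
qed

lemma pullback_collapsed:
  assumes "q \<in> SR_part 2 \<Gamma>" "{a, b} \<in> \<Delta>" "\<phi> a = \<phi> b"
  shows "SR_eval (pullback q) (collapsed a b) = 0"
proof -
  have r: "(\<lambda>_. 0) \<in> realization \<Gamma>"
    using push_realization[OF collapsed_realization[OF assms(2)]] push_collapsed[OF assms(2,3)] by simp
  obtain A where A: "\<And>x. x \<in> realization \<Gamma> \<Longrightarrow> SR_eval q x = quad (vertices \<Gamma>) A x"
    by (rule G.SR_part2_eval[OF assms(1)]) (rule that)
  show ?thesis
    using A[OF r] pullback(2)[OF assms(1) collapsed_realization[OF assms(2)]]
      push_collapsed[OF assms(2,3)] by (simp add: quad_def)
qed

text \<open>Squeezed between 0 and the pullback, \<open>y\<close> vanishes at the collapsed vectors.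
  The kernel condition and \<open>edge_fibre_invariant\<close> then make its coefficients on
  vertices and edges depend only on the images of the endpoints, and these give the matrix of
  \<open>y'\<close>.\<close>

lemma descend:
  assumes q: "q \<in> SR_part 2 \<Gamma>" and y: "y \<in> nonneg_cone \<Delta>"
    and le: "\<And>x. x \<in> realization \<Delta> \<Longrightarrow> SR_eval y x \<le> SR_eval (pullback q) x"
  obtains y' where "y' \<in> nonneg_cone \<Gamma>" "\<And>x. x \<in> realization \<Delta> \<Longrightarrow> SR_eval y x = SR_eval y' (p x)"
proof -
  let ?V = "vertices \<Delta>" and ?W = "vertices \<Gamma>"
  have y2: "y \<in> SR_part 2 \<Delta>" and y0: "\<And>x. x \<in> realization \<Delta> \<Longrightarrow> 0 \<le> SR_eval y x"
    using y D.nonneg_cone_iff by auto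
  obtain Y where sym: "\<And>i j. Y i j = Y j i"
    and Y: "\<And>x. x \<in> realization \<Delta> \<Longrightarrow> SR_eval y x = quad ?V Y x"
    by (rule D.SR_part2_eval[OF y2]) (rule that)
  have ker: "Y a c = Y b c" if f: "{a, b, c} \<in> \<Delta>" "\<phi> a = \<phi> b" for a b c
  proof (rule quad_kernel[OF sym D.finite_vertices])
    have ab: "{a, b} \<in> \<Delta>" using D.face_subset[OF f(1), of "{a, b}"] by blast
    show "a \<in> ?V" "b \<in> ?V" "c \<in> ?V" using D.face_subset_vertices[OF f(1)] by auto
    show "0 \<le> quad ?V Y x" if "x \<in> coord_span {a, b, c}" for x
      using Y[of x] y0[of x] f(1) that by (metis UN_I)
    note r = collapsed_realization[OF ab]
    show "quad ?V Y (\<lambda>i. of_bool (i = a) - of_bool (i = b)) = 0"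
      using le[OF r] y0[OF r] pullback_collapsed[OF q ab f(2)] Y[OF r] by (simp add: collapsed_def)
  qed
  \<comment> \<open>Any edge or vertex over the pair may be used, by
    \<open>edge_fibre_invariant\<close>. Pairs with nothing above them get an arbitrary value, which
    the points \<open>p x\<close> never see.\<close>
  define Y' where "Y' c d = (SOME r. \<exists>a b. {a, b} \<in> \<Delta> \<and> \<phi> a = c \<and> \<phi> b = d \<and> r = Y a b)" for c d
  have Y': "Y' (\<phi> a) (\<phi> b) = Y a b" if ab: "{a, b} \<in> \<Delta>" for a b
  proof -
    have "\<exists>a' b'. {a', b'} \<in> \<Delta> \<and> \<phi> a' = \<phi> a \<and> \<phi> b' = \<phi> b \<and> Y' (\<phi> a) (\<phi> b) = Y a' b'"
      unfolding Y'_def by (rule someI_ex) (use ab in blast)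
    then obtain a' b' where a'b': "{a', b'} \<in> \<Delta>" "\<phi> a' = \<phi> a" "\<phi> b' = \<phi> b"
      and Y': "Y' (\<phi> a) (\<phi> b) = Y a' b'" by blast
    have "Y a' b' = Y a b"
    proof (rule edge_fibre_invariant[where Y = Y])
      show "Y a c = Y b c" if "{a, b, c} \<in> \<Delta>" "\<phi> a = \<phi> b" for a b c using that by (rule ker)
    qed (rule sym a'b' ab)+
    then show ?thesis using Y' by simp
  qed
  have eq: "SR_eval y x = quad ?W Y' (p x)" if x: "x \<in> realization \<Delta>" for x
  proof -
    obtain T where T: "T \<in> \<Delta>" "x \<in> coord_span T" using x by blast
    have "quad ?V Y x = quad ?V (\<lambda>i j. Y' (\<phi> i) (\<phi> j)) x"
      unfolding quad_def
    proof (intro sum.cong refl)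
      fix i j
      \<comment> \<open>Only indices in the face supporting \<open>x\<close> contribute, and for
        these {i, j} is a face.\<close>
      show "Y i j * x i * x j = Y' (\<phi> i) (\<phi> j) * x i * x j"
      proof (cases "{i, j} \<subseteq> T")
        case True
        then show ?thesis using Y' D.face_subset[OF T(1)] by simp
      next
        case False
        then show ?thesis using T(2) by (auto simp: coord_span_def)
      qed
    qed
    then show ?thesis using Y[OF x] quad_push by simp
  qed
  define y' where "y' = G.cl (quad_poly ?W Y')"
  have y': "SR_eval y x = SR_eval y' (p x)" if x: "x \<in> realization \<Delta>" for x
    unfolding y'_def G.quad_class_eval[OF push_realization[OF x]] by (rule eq[OF x])
  have "y' \<in> nonneg_cone \<Gamma>"
    unfolding G.nonneg_cone_iff
  proof
    show "y' \<in> SR_part 2 \<Gamma>" unfolding y'_def by (rule G.quad_class)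
    show "\<forall>x\<in>realization \<Gamma>. 0 \<le> SR_eval y' x" using y' y0 realization_lift by metis
  qed
  then show ?thesis using y' that by blast
qed

text \<open>At a collapsed vector the squares sum to 0, so every linear form among them is constant
  along collapsed edges, hence on fibres, and descends to \<Gamma>.\<close>

lemma pullback_sos:
  assumes q: "q \<in> SR_part 2 \<Gamma>" and sos: "pullback q \<in> sos_cone \<Delta>"
  shows "q \<in> sos_cone \<Gamma>"
proof -
  let ?V = "vertices \<Delta>" and ?W = "vertices \<Gamma>"
  obtain k :: nat and a where
    a: "\<And>x. x \<in> realization \<Delta> \<Longrightarrow> SR_eval (pullback q) x = (\<Sum>j<k. (\<Sum>i\<in>?V. a j i * x i)\<^sup>2)"
    using sos unfolding D.sos_cone_iff[OF pullback(1)[OF q]] by blast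
  have step: "a j u = a j v" if uv: "{u, v} \<in> \<Delta>" "\<phi> u = \<phi> v" and j: "j < k" for j u v
  proof -
    have V: "u \<in> ?V" "v \<in> ?V" using D.face_subset_vertices[OF uv(1)] by auto
    have "(\<Sum>i\<in>?V. a j i * collapsed u v i) = a j u - a j v" for j
      unfolding collapsed_def
      using V D.finite_vertices by (simp add: right_diff_distrib sum_subtractf sum_indicator)
    then have "(\<Sum>j<k. (a j u - a j v)\<^sup>2) = 0"
      using a[OF collapsed_realization[OF uv(1)]] pullback_collapsed[OF q uv] by simp
    then show ?thesis using j by (simp add: sum_nonneg_eq_0_iff)
  qed
  define a' where "a' j c = a j (SOME i. i \<in> ?V \<and> \<phi> i = c)" for j c
  have a': "a' j (\<phi> i) = a j i" if i: "i \<in> ?V" and j: "j < k" for i j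
  proof -
    have some: "(SOME i'. i' \<in> ?V \<and> \<phi> i' = \<phi> i) \<in> ?V \<and> \<phi> (SOME i'. i' \<in> ?V \<and> \<phi> i' = \<phi> i) = \<phi> i"
      by (rule someI) (use i in blast)
    show ?thesis
      unfolding a'_def
    proof (rule fibre_invariant[where f = "a j"])
      show "a j u = a j v" if "{u, v} \<in> \<Delta>" "\<phi> u = \<phi> v" for u v using step[OF that j] .
    qed (rule some[THEN conjunct1] i some[THEN conjunct2])+
  qed
  have "SR_eval q x = (\<Sum>j<k. (\<Sum>c\<in>?W. a' j c * x c)\<^sup>2)" if x: "x \<in> realization \<Gamma>" for x
  proof -
    obtain y where y: "y \<in> realization \<Delta>" "p y = x" by (rule realization_lift[OF x])
    have "SR_eval q x = (\<Sum>j<k. (\<Sum>i\<in>?V. a j i * y i)\<^sup>2)"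
      unfolding y(2)[symmetric] pullback(2)[OF q y(1), symmetric] by (rule a[OF y(1)])
    also have "\<dots> = (\<Sum>j<k. (\<Sum>i\<in>?V. a' j (\<phi> i) * y i)\<^sup>2)"
      by (intro sum.cong refl arg_cong[where f = "\<lambda>t. t\<^sup>2"]) (simp add: a')
    finally show ?thesis using linear_push[of _ y] y by simp
  qed
  then show ?thesis unfolding G.sos_cone_iff[OF q] by blast
qed

text \<open>Each summand of a decomposition is bounded by the pullback because the other is
  nonnegative, so both descend. A linear relation between the descended forms pulls back to one
  between the summands, so independence survives the descent.\<close>

lemma pullback_extreme:
  assumes "spans_extreme_ray \<Gamma> (nonneg_cone \<Gamma>) q"
  shows "spans_extreme_ray \<Delta> (nonneg_cone \<Delta>) (pullback q)"
proof -
  have q: "q \<in> nonneg_cone \<Gamma>" "q \<noteq> \<zero>\<^bsub>SR_ring \<Gamma>\<^esub>"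
    and ext: "\<And>y z. y \<in> nonneg_cone \<Gamma> \<Longrightarrow> z \<in> nonneg_cone \<Gamma> \<Longrightarrow> SR_independent \<Gamma> y z \<Longrightarrow>
        q \<noteq> y \<oplus>\<^bsub>SR_ring \<Gamma>\<^esub> z"
    using assms unfolding spans_extreme_ray_def by blast+
  have q2: "q \<in> SR_part 2 \<Gamma>" using q G.nonneg_cone_iff by blast
  have "q = \<zero>\<^bsub>SR_ring \<Gamma>\<^esub>" if z: "pullback q = \<zero>\<^bsub>SR_ring \<Delta>\<^esub>"
  proof (rule G.SR_part2_eqI[OF q2 G.SR_zero(1)])
    fix x assume x: "x \<in> realization \<Gamma>"
    then obtain y where "y \<in> realization \<Delta>" "p y = x" using realization_lift by blast
    then show "SR_eval q x = SR_eval \<zero>\<^bsub>SR_ring \<Gamma>\<^esub> x"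
      using pullback(2)[OF q2] z D.SR_zero(2) G.SR_zero(2)[OF x] by metis
  qed
  moreover have False
    if y: "y \<in> nonneg_cone \<Delta>" and z: "z \<in> nonneg_cone \<Delta>" and ind: "SR_independent \<Delta> y z"
      and sum: "pullback q = y \<oplus>\<^bsub>SR_ring \<Delta>\<^esub> z" for y z
  proof -
    have y2: "y \<in> SR_part 2 \<Delta>" and z2: "z \<in> SR_part 2 \<Delta>" using y z D.nonneg_cone_iff by auto
    have yz: "SR_eval (pullback q) x = SR_eval y x + SR_eval z x"
      "0 \<le> SR_eval y x" "0 \<le> SR_eval z x" if "x \<in> realization \<Delta>" for x
      using sum D.SR_add(2)[OF y2 z2 that] y z that D.nonneg_cone_iff by auto
    obtain y' where y': "y' \<in> nonneg_cone \<Gamma>" "\<And>x. x \<in> realization \<Delta> \<Longrightarrow> SR_eval y x = SR_eval y' (p x)"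
      using descend[OF q2 y] yz by (metis add.commute le_add_same_cancel2)
    obtain z' where z': "z' \<in> nonneg_cone \<Gamma>" "\<And>x. x \<in> realization \<Delta> \<Longrightarrow> SR_eval z x = SR_eval z' (p x)"
      using descend[OF q2 z] yz by (metis le_add_same_cancel2)
    have y2': "y' \<in> SR_part 2 \<Gamma>" and z2': "z' \<in> SR_part 2 \<Gamma>" using y' z' G.nonneg_cone_iff by auto
    have "q = y' \<oplus>\<^bsub>SR_ring \<Gamma>\<^esub> z'"
    proof (rule G.SR_part2_eqI[OF q2 G.SR_add(1)[OF y2' z2']])
      fix x assume x: "x \<in> realization \<Gamma>"
      then obtain w where "w \<in> realization \<Delta>" "p w = x" using realization_lift by blast
      then show "SR_eval q x = SR_eval (y' \<oplus>\<^bsub>SR_ring \<Gamma>\<^esub> z') x"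
        using G.SR_add(2)[OF y2' z2' x] yz(1) y'(2) z'(2) pullback(2)[OF q2] by metis
    qed
    moreover have "SR_independent \<Gamma> y' z'"
      unfolding G.SR_independent_iff[OF y2' z2']
      using ind[unfolded D.SR_independent_iff[OF y2 z2]] y'(2) z'(2) push_realization by metis
    ultimately show False using ext y'(1) z'(1) by blast
  qed
  ultimately show ?thesis
    using q pullback_nonneg unfolding spans_extreme_ray_def by blast
qed

text \<open>Over a face attaining the local rank, a section into a lifted face embeds
  \<open>coord_span F\<close> into \<open>coord_span T\<close>; restricting the squares on
  \<open>T\<close> along it gives as many squares on \<open>F\<close>.\<close>

lemma local_rank_pullback:
  assumes q: "q \<in> nonneg_cone \<Gamma>"
  shows "local_rank \<Gamma> q \<le> local_rank \<Delta> (pullback q)"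
proof (cases "\<Gamma> = {}")
  case True
  \<comment> \<open>Both local ranks are then the same unspecified \<open>Max {}\<close>.\<close>
  then have "\<Delta> = {}" using face_image by blast
  then show ?thesis using True by (simp add: local_rank_def)
next
  case False
  have q2: "q \<in> SR_part 2 \<Gamma>" using q G.nonneg_cone_iff by blast
  obtain F where F: "F \<in> \<Gamma>" "local_rank \<Gamma> q = form_rank F (SR_eval q)"
    using G.local_rank_attained[OF False] by blast
  obtain T where T: "T \<in> \<Delta>" "\<phi> ` T = F" using face_lift F by blast
  note TV = D.face_subset_vertices[OF T(1)]
  have "\<forall>c\<in>F. \<exists>i. i \<in> T \<and> \<phi> i = c" using T(2) by blast
  then obtain s where s: "\<And>c. c \<in> F \<Longrightarrow> s c \<in> T \<and> \<phi> (s c) = c" by metis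
  define r where "r = form_rank T (SR_eval (pullback q))"
  obtain a where a: "\<And>x. x \<in> coord_span T \<Longrightarrow>
      SR_eval (pullback q) x = (\<Sum>j<r. (\<Sum>i\<in>T. a j i * x i)\<^sup>2)"
    using D.form_rank_properties(1)[OF pullback_nonneg[OF q] T(1)] unfolding r_def by blast
  have "SR_eval q x = (\<Sum>j<r. (\<Sum>c\<in>F. a j (s c) * x c)\<^sup>2)" if x: "x \<in> coord_span F" for x
  proof -
    define y where "y = (\<lambda>i. if i \<in> s ` F then x (\<phi> i) else 0)"
    have y: "y \<in> coord_span T" "p y = x"
      unfolding y_def using push_section[OF s TV D.finite_vertices x] by auto
    have inj: "inj_on s F" using s by (metis inj_onI)
    have "(\<Sum>i\<in>T. a j i * y i) = (\<Sum>c\<in>F. a j (s c) * x c)" for j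
    proof -
      have "finite T" using TV D.finite_vertices finite_subset by blast
      then have "(\<Sum>i\<in>T. a j i * y i) = (\<Sum>i\<in>s ` F. a j i * y i)"
        using s by (intro sum.mono_neutral_right) (auto simp: y_def)
      also have "\<dots> = (\<Sum>c\<in>F. a j (s c) * x c)"
        using s by (subst sum.reindex[OF inj]) (auto simp: y_def intro!: sum.cong)
      finally show ?thesis .
    qed
    moreover have "SR_eval q x = SR_eval (pullback q) y"
      using pullback(2)[OF q2] y T(1) by (metis UN_I)
    ultimately show ?thesis using a[OF y(1)] by simp
  qed
  then have "form_rank F (SR_eval q) \<le> r"
    unfolding form_rank_def by (intro Least_le exI[of _ "\<lambda>j c. a j (s c)"]) blast
  also have "r \<le> local_rank \<Delta> (pullback q)" unfolding r_def by (rule D.form_rank_le_local_rank[OF T(1)])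
  finally show ?thesis using F(2) by simp
qed

text \<open>Faces lift, so \<Gamma> is the image complex, and the first connectivity condition makes
  the contraction argument applicable.\<close>

lemma chordal_image:
  assumes "chordal_complex \<Delta>"
  shows "chordal_complex \<Gamma>"
proof -
  have "(`) \<phi> ` \<Delta> = \<Gamma>" using face_image face_lift by fast
  moreover have "chordal_complex ((`) \<phi> ` \<Delta>)"
    by (rule chordal_complex_connected_fibres[OF D.finite_vertices assms fibre_connected])
  ultimately show ?thesis by simp
qed

lemma elocr_mono: "elocr \<Gamma> \<le> elocr \<Delta>"
proof (cases "chordal_complex \<Gamma>")
  case True
  then show ?thesis by (simp add: elocr_def)
next
  case False
  have \<Gamma>: "elocr \<Gamma> = Sup {local_rank \<Gamma> q | q. q \<in> nonneg_cone \<Gamma> - sos_cone \<Gamma> \<and>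
      spans_extreme_ray \<Gamma> (nonneg_cone \<Gamma>) q}" (is "_ = Sup ?S\<Gamma>")
    using False by (simp add: elocr_def)
  have \<Delta>: "elocr \<Delta> = Sup {local_rank \<Delta> q | q. q \<in> nonneg_cone \<Delta> - sos_cone \<Delta> \<and>
      spans_extreme_ray \<Delta> (nonneg_cone \<Delta>) q}" (is "_ = Sup ?S\<Delta>")
    using False chordal_image by (auto simp: elocr_def)
  have bdd: "bdd_above ?S\<Delta>"
  proof (rule bdd_aboveI)
    fix n assume "n \<in> ?S\<Delta>"
    \<comment> \<open>For an empty complex \<open>local_rank\<close> is the unspecified
      \<open>Max {}\<close>, so the bound has to include it.\<close>
    then show "n \<le> max (card (vertices \<Delta>)) (Max {})"
      using D.local_rank_le_card by (cases "\<Delta> = {}") (auto simp: local_rank_def le_max_iff_disj)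
  qed
  show ?thesis
  \<comment> \<open>\<open>cSup_mono\<close> asks for a nonempty set; the supremum of the empty set
    is 0.\<close>
  proof (cases "?S\<Gamma> = {}")
    case True
    then show ?thesis unfolding \<Gamma> by (simp only: Sup_nat_empty le0)
  next
    case False
    have "\<exists>m\<in>?S\<Delta>. n \<le> m" if n: "n \<in> ?S\<Gamma>" for n
    proof -
      obtain q where q: "n = local_rank \<Gamma> q" "q \<in> nonneg_cone \<Gamma>" "q \<notin> sos_cone \<Gamma>"
        "spans_extreme_ray \<Gamma> (nonneg_cone \<Gamma>) q" using n by blast
      then have "q \<in> SR_part 2 \<Gamma>" using G.nonneg_cone_iff by blast
      then have "local_rank \<Delta> (pullback q) \<in> ?S\<Delta>"
        using pullback_nonneg pullback_sos pullback_extreme q by blast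
      then show ?thesis using local_rank_pullback q by blast
    qed
    then show ?thesis unfolding \<Gamma> \<Delta> by (intro cSup_mono[OF False bdd])
  qed
qed

end

theorem corollary3p11:
  fixes \<Delta> :: "'a set set" and \<Gamma> :: "'b set set"
  assumes "finite_complex \<Delta>" and "finite_complex \<Gamma>"
    and "\<exists>\<phi>. strongly_connected_map \<Delta> \<Gamma> \<phi>"
  shows "elocr \<Delta> \<ge> elocr \<Gamma>"
  using assms strong_map.elocr_mono
  by (metis simplicial_complex.intro strong_map.intro strong_map_axioms.intro)

end
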